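(* Let $1<p<\infty$ and $\frac1p+\frac1q=1$. Let $I$ be an inner function with spectrum $\sigma(I)$. Let $\Gamma\subset\mathbb{T}$ be a closed arc not meeting $\sigma(I)$, and let $g$ be an outer function in $H^p$ such that $|g|\ge\delta$ (a.e.) on $\mathbb{T}\setminus\Gamma$ for some constant $\delta>0$ and $1/g\in L^s(\Gamma)$ for some $s>q$. Then $K^p_I(|g|^p)\subset K^p_I$. If moreover $g$ is bounded, then $K^p_I(|g|^p)= K^p_I$.
   Context: $\mathbb{D}$ is the open unit disk, $\mathbb{T}$ the unit circle, $H^p$ the Hardy space of $\mathbb{D}$; $\operatorname{clos}$ denotes closure. For an outer function $g\in H^p$, $H^p(|g|^p)=\{f \text{ holomorphic in }\mathbb{D}: fg\in H^p\}$ and $H^p_0(|g|^p)=\{\psi\in H^p(|g|^p):\psi(0)=0\}$. For an inner function $I$, $K^p_I(|g|^p)$ is the set of $f\in H^p(|g|^p)$ for which there is $\psi\in H^p_0(|g|^p)$ with $f=I\overline{\psi}$ a.e. on $\mathbb{T}$ (boundary values); $K^p_I=H^p\cap I\,\overline{H^p_0}$ is the unweighted case $g\equiv1$. The spectrum of $I$ is $\sigma(I)=\{\lambda\in\operatorname{clos}\mathbb{D}:\liminf_{z\to\lambda,\,z\in\mathbb{D}}|I(z)|=0\}$. *)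

theory Defs
  imports "HOL-Complex_Analysis.Complex_Analysis"
begin

text \<open>Functions on the open unit disk are total functions on the complex numbers of which
  only the values on \<^term>\<open>ball 0 1 :: complex set\<close> matter. The unit circle is parametrised
  by \<^term>\<open>cis\<close>, and its arc length measure is transported to the parameter interval.\<close>

abbreviation circle_measure :: "real measure" where
  "circle_measure \<equiv> lebesgue_on {0..2 * pi}"

text \<open>Boundary values are radial limits. For the functions considered here they exist
  almost everywhere (Fatou) and agree with the nontangential limits. An almost everywhere
  statement about boundary values is read as: for almost every point the radial limits
  exist and satisfy the stated relation, so no conventional value is used where a limit
  fails to exist.\<close>

definition has_boundary_value :: "(complex \<Rightarrow> complex) \<Rightarrow> real \<Rightarrow> complex \<Rightarrow> bool" where
  "has_boundary_value f t w \<longleftrightarrow> ((\<lambda>r. f (rcis r t)) \<longlongrightarrow> w) (at_left 1)"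

definition hardy_space :: "real \<Rightarrow> (complex \<Rightarrow> complex) set" where
  "hardy_space p =
    {f. f holomorphic_on ball 0 1 \<and>
        bdd_above ((\<lambda>r. LINT t|circle_measure. norm (f (rcis r t)) powr p) ` {0..<1})}"

definition inner_function :: "(complex \<Rightarrow> complex) \<Rightarrow> bool" where
  "inner_function I \<longleftrightarrow>
    I holomorphic_on ball 0 1 \<and> (\<forall>z\<in>ball 0 1. norm (I z) \<le> 1) \<and>
    (AE t in circle_measure. \<exists>w. has_boundary_value I t w \<and> norm w = 1)"

text \<open>Here \<^term>\<open>k\<close> is the prescribed boundary modulus.\<close>

definition outer_function :: "(complex \<Rightarrow> complex) \<Rightarrow> bool" where
  "outer_function g \<longleftrightarrow>
    (\<exists>c k. norm c = 1 \<and> k \<in> borel_measurable circle_measure \<and> (\<forall>t. 0 < k t) \<and>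
      integrable circle_measure (\<lambda>t. ln (k t)) \<and>
      (\<forall>z\<in>ball 0 1. g z = c * exp (1 / (2 * pi) *
         (LINT t|circle_measure. (cis t + z) / (cis t - z) * complex_of_real (ln (k t))))))"

definition weighted_hardy_space ::
    "real \<Rightarrow> (complex \<Rightarrow> complex) \<Rightarrow> (complex \<Rightarrow> complex) set" where
  "weighted_hardy_space p g =
    {f. f holomorphic_on ball 0 1 \<and> (\<lambda>z. f z * g z) \<in> hardy_space p}"

definition weighted_hardy_space0 ::
    "real \<Rightarrow> (complex \<Rightarrow> complex) \<Rightarrow> (complex \<Rightarrow> complex) set" where
  "weighted_hardy_space0 p g = {\<psi> \<in> weighted_hardy_space p g. \<psi> 0 = 0}"

definition weighted_model_space ::
    "real \<Rightarrow> (complex \<Rightarrow> complex) \<Rightarrow> (complex \<Rightarrow> complex) \<Rightarrow> (complex \<Rightarrow> complex) set" where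
  "weighted_model_space p I g =
    {f \<in> weighted_hardy_space p g. \<exists>\<psi>\<in>weighted_hardy_space0 p g.
       AE t in circle_measure. \<exists>u v w. has_boundary_value f t u \<and> has_boundary_value I t v \<and>
         has_boundary_value \<psi> t w \<and> u = v * cnj w}"

definition model_space :: "real \<Rightarrow> (complex \<Rightarrow> complex) \<Rightarrow> (complex \<Rightarrow> complex) set" where
  "model_space p I = weighted_model_space p I (\<lambda>_. 1)"

definition spectrum :: "(complex \<Rightarrow> complex) \<Rightarrow> complex set" where
  "spectrum I =
    {l \<in> closure (ball 0 1). Liminf (at l within ball 0 1) (\<lambda>z. ereal (norm (I z))) = 0}"

text \<open>Single points and the whole circle are admitted.\<close>

definition closed_arc :: "complex set \<Rightarrow> bool" where
  "closed_arc \<Gamma> \<longleftrightarrow> (\<exists>a b. a \<le> b \<and> \<Gamma> = cis ` {a..b})"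

text \<open>The boundary function of \<^term>\<open>f\<close> restricted to \<^term>\<open>\<Gamma>\<close> is in the Lebesgue
  space of exponent \<^term>\<open>s\<close>.\<close>

definition boundary_in_Lp ::
    "real \<Rightarrow> complex set \<Rightarrow> (complex \<Rightarrow> complex) \<Rightarrow> bool" where
  "boundary_in_Lp s \<Gamma> f \<longleftrightarrow>
    (\<exists>F. F \<in> borel_measurable circle_measure \<and>
      (AE t in circle_measure. cis t \<in> \<Gamma> \<longrightarrow> has_boundary_value f t (F t)) \<and>
      integrable circle_measure (\<lambda>t. indicator \<Gamma> (cis t) * norm (F t) powr s))"

end

theory Submission
  imports Defs
begin

text \<open>Let \<open>f\<close> be the product of \<open>I\<close> and the conjugate of \<open>\<psi>\<close> on the circle, with \<open>f g\<close> and \<open>\<psi> g\<close> in \<open>H\<^sup>p\<close>.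
  Since \<open>1/g\<close> is bounded off \<open>\<Gamma>\<close> and in \<open>L\<^sup>s\<close> on \<open>\<Gamma>\<close> with \<open>s > q\<close>, the common boundary modulus of
  \<open>f\<close> and \<open>\<psi>\<close> lies in \<open>L\<^sup>r\<close> for some \<open>r > 1\<close>. Because \<open>g\<close> is outer, \<open>f\<close> and \<open>\<psi>\<close> are dominated by the
  Poisson integral of this modulus, and so belong to \<open>H\<^sup>r\<close>. Near a point of \<open>\<Gamma>\<close> the modulus of \<open>I\<close> is
  bounded below, and the reflection of \<open>\<psi>/I\<close> in the circle continues \<open>f\<close> across the circle. A Cauchy
  integral over a contour crossing the circle then shows that \<open>f\<close> is bounded near \<open>\<Gamma>\<close>. Hence the
  boundary modulus is in \<open>L\<^sup>p\<close>, and the Poisson domination gives \<open>f\<close> and \<open>\<psi>\<close> in \<open>H\<^sup>p\<close>.\<close>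

section \<open>Integrals over the circle\<close>

text \<open>A bound on the boundary modulus of \<open>f\<close> does not by itself bound
  \<open>f\<close>: the reciprocal of a singular inner function has boundary modulus 1 almost
  everywhere. That \<open>g\<close> is outer excludes such behaviour, and the form in which this is
  used is a pointwise bound by a Poisson integral, which makes no reference to an exponent and so
  can be used twice, for \<open>r\<close> and for \<open>p\<close>. By Hoelder the weight alone
  yields \<open>1 / r = 1 / p + 1 / s\<close>, and \<open>s > q\<close> makes this less than 1. That
  \<open>r\<close> exceeds 1 is needed for the gluing: radial limits almost everywhere do not
  control Cauchy integrals along circles close to the boundary, but boundedness in
  \<open>L\<^sup>r\<close> with \<open>r > 1\<close> upgrades them to convergence in mean. The
  gluing uses the coordinate \<open>w\<close> with \<open>z = exp w\<close>. There the circle is the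
  imaginary axis, radial approach is horizontal, reflection is \<open>w \<mapsto> - cnj w\<close>,
  and the contours are rectangles. Of \<open>I\<close> only a lower bound on the disk side and its
  boundary values enter; \<open>I\<close> itself is never continued.\<close>

lemma finite_measure_circle: "finite_measure circle_measure"
  by (rule finite_measure_lebesgue_on) simp

interpretation circle: finite_measure circle_measure
  by (rule finite_measure_circle)

lemma continuous_integrable_circle [intro]:
  fixes f :: "real \<Rightarrow> 'b::euclidean_space"
  assumes "continuous_on {0..2*pi} f"
  shows "integrable circle_measure f"
  using assms by (rule continuous_imp_integrable_real)

lemma circle_pair_sigma_finite: "pair_sigma_finite circle_measure circle_measure"
  by unfold_locales

lemma (in finite_measure) integrable_of_powr:
  fixes f :: "'a \<Rightarrow> real"
  assumes "1 \<le> p" "f \<in> borel_measurable M" "integrable M (\<lambda>x. \<bar>f x\<bar> powr p)"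
  shows "integrable M f"
proof (rule Bochner_Integration.integrable_bound)
  show "integrable M (\<lambda>x. 1 + \<bar>f x\<bar> powr p)" using assms by simp
  have "\<bar>y\<bar> \<le> 1 + \<bar>y\<bar> powr p" for y :: real
  proof (cases "\<bar>y\<bar> \<le> 1")
    case False
    then have "\<bar>y\<bar> powr 1 \<le> \<bar>y\<bar> powr p" using assms(1) by (intro powr_mono) auto
    then show ?thesis using False by simp
  qed (smt (verit) powr_ge_zero)
  then show "AE x in M. norm (f x) \<le> norm (1 + \<bar>f x\<bar> powr p)"
    by (smt (verit) AE_I2 powr_ge_zero real_norm_def)
qed fact

text \<open>Boundedness in \<open>L\<^sup>p\<close> with \<open>p > 1\<close> gives uniform integrability, so that almost everywhere
  convergence implies convergence in mean.\<close>

lemma (in finite_measure) integral_tendsto_0_of_Lp_bounded: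
  fixes X :: "nat \<Rightarrow> 'a \<Rightarrow> real"
  assumes p: "1 < p" and meas: "\<And>j. X j \<in> borel_measurable M"
    and nn: "\<And>j x. 0 \<le> X j x"
    and lim: "AE x in M. (\<lambda>j. X j x) \<longlonglongrightarrow> 0"
    and int: "\<And>j. integrable M (\<lambda>x. X j x powr p)"
    and bd: "\<And>j. (LINT x|M. X j x powr p) \<le> B"
  shows "(\<lambda>j. LINT x|M. X j x) \<longlonglongrightarrow> 0"
proof (rule LIMSEQ_I)
  fix e :: real assume e: "0 < e"
  define B' where "B' = max B 1"
  have B': "0 < B'" "B \<le> B'" by (auto simp: B'_def)
  \<comment> \<open>The truncation height makes the part above it harmless: there
    \<open>x = x powr (1 - p) * x powr p\<close>, and \<open>1 - p < 0\<close>, so that part has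
    integral at most \<open>K powr (1 - p) * B' = e / 2\<close>. \<open>B'\<close> replaces
    \<open>B\<close> to have a positive denominator.\<close>
  define K where "K = (e / (2 * B')) powr (1 / (1 - p))"
  have Kpos: "0 < K" using e B' by (simp add: K_def)
  have Kp: "K powr (1 - p) = e / (2 * B')" using e B' p by (simp add: K_def powr_powr)
  have iX: "integrable M (X j)" for j
    using integrable_of_powr[of p "X j"] p meas int nn by simp
  have imin: "integrable M (\<lambda>x. min (X j x) K)" for j
    by (rule Bochner_Integration.integrable_bound[OF iX[of j]]) (use meas nn Kpos in \<open>auto simp: abs_if\<close>)
  have split: "X j x \<le> min (X j x) K + K powr (1 - p) * X j x powr p" for j x
  proof (cases "X j x \<le> K")
    case False
    then have "X j x = X j x powr (1 - p) * X j x powr p"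
      using Kpos by (simp add: powr_add[symmetric])
    also have "\<dots> \<le> K powr (1 - p) * X j x powr p"
      using False Kpos p by (intro mult_right_mono powr_mono2') auto
    finally show ?thesis using False Kpos by simp
  qed simp
  have "(\<lambda>j. LINT x|M. min (X j x) K) \<longlonglongrightarrow> (LINT x|M. 0)"
  proof (rule integral_dominated_convergence[where w="\<lambda>_. K"])
    show "AE x in M. (\<lambda>j. min (X j x) K) \<longlonglongrightarrow> 0"
      using lim
    proof eventually_elim
      case (elim x)
      from tendsto_min[OF elim tendsto_const[of K]] show ?case using Kpos by simp
    qed
    show "AE x in M. norm (min (X j x) K) \<le> K" for j
    proof (intro AE_I2)
      fix x
      show "norm (min (X j x) K) \<le> K" using nn[of j x] Kpos by simp
    qed
  qed (use meas in auto)
  then have "\<forall>\<^sub>F j in sequentially. (LINT x|M. min (X j x) K) < e / 2"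
    using e by (intro order_tendstoD(2)) auto
  then obtain N where N: "\<And>j. j \<ge> N \<Longrightarrow> (LINT x|M. min (X j x) K) < e / 2"
    by (auto simp: eventually_sequentially)
  show "\<exists>N. \<forall>j\<ge>N. norm ((LINT x|M. X j x) - 0) < e"
  proof (intro exI allI impI)
    fix j assume "N \<le> j"
    have "(LINT x|M. X j x) \<le> (LINT x|M. min (X j x) K + K powr (1 - p) * X j x powr p)"
      by (intro integral_mono split iX Bochner_Integration.integrable_add imin integrable_mult_right int)
    also have "\<dots> = (LINT x|M. min (X j x) K) + K powr (1 - p) * (LINT x|M. X j x powr p)"
      using imin int by simp
    also have "\<dots> < e / 2 + K powr (1 - p) * B'"
      using N[OF \<open>N \<le> j\<close>] bd[of j] B' by (intro add_less_le_mono mult_left_mono) auto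
    also have "\<dots> = e" using B' Kp by simp
    finally show "norm ((LINT x|M. X j x) - 0) < e"
      using nn by (simp add: integral_nonneg_AE)
  qed
qed

section \<open>The Poisson kernel\<close>

text \<open>The factor \<open>1 / (2 * pi)\<close> is left out, so the total mass is
  \<open>2 * pi\<close> and the factor stands in front of every Poisson mean.\<close>

definition poisson_kernel :: "complex \<Rightarrow> real \<Rightarrow> real" where
  "poisson_kernel z t = (1 - (norm z)\<^sup>2) / (norm (cis t - z))\<^sup>2"

lemma cis_neq_inside: "norm z < 1 \<Longrightarrow> cis t \<noteq> z"
  using norm_cis by force

lemma cis_diff_ge: "1 - norm z \<le> norm (cis t - z)"
  using norm_triangle_ineq2[of "cis t" z] by simp

lemma poisson_kernel_nonneg: "norm z < 1 \<Longrightarrow> 0 \<le> poisson_kernel z t"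
  by (simp add: poisson_kernel_def power_le_one)

lemma poisson_kernel_le:
  assumes "norm z < 1"
  shows "poisson_kernel z t \<le> 2 / (1 - norm z)"
proof -
  have "poisson_kernel z t \<le> (1 - (norm z)\<^sup>2) / (1 - norm z)\<^sup>2"
    unfolding poisson_kernel_def using assms cis_diff_ge[of z t]
    by (intro divide_left_mono power_mono mult_pos_pos zero_less_power)
       (auto simp: power_le_one cis_neq_inside)
  also have "\<dots> = (1 + norm z) / (1 - norm z)"
    using assms by (simp add: divide_simps power2_eq_square) (simp add: algebra_simps)
  also have "\<dots> \<le> 2 / (1 - norm z)"
    using assms by (intro divide_right_mono) auto
  finally show ?thesis .
qed

lemma continuous_poisson_kernel:
  "norm z < 1 \<Longrightarrow> continuous_on A (poisson_kernel z)"
  unfolding poisson_kernel_def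
  by (intro continuous_intros) (auto simp: cis_neq_inside)

text \<open>Ties the exponent of an outer function to Poisson integrals. After multiplication by the
  conjugate of the denominator, the numerator has real part
  \<open>|cis t|^2 - |z|^2\<close>.\<close>

lemma poisson_kernel_Re:
  assumes "norm z < 1"
  shows "Re ((cis t + z) / (cis t - z)) = poisson_kernel z t"
proof -
  have "(cis t + z) / (cis t - z) = (cis t + z) * cnj (cis t - z) / (norm (cis t - z))\<^sup>2"
    using cis_neq_inside[OF assms, of t]
    unfolding complex_norm_square by (simp add: field_simps del: complex_cnj_diff)
  moreover have "Re ((cis t + z) * cnj (cis t - z)) = 1 - (norm z)\<^sup>2"
  proof -
    have "Re ((a + z) * cnj (a - z)) = (norm a)\<^sup>2 - (norm z)\<^sup>2" for a
      by (simp add: cmod_def algebra_simps power2_eq_square)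
    from this[of "cis t"] show ?thesis by simp
  qed
  ultimately show ?thesis by (simp add: poisson_kernel_def Re_divide_of_real)
qed

text \<open>Both distances have the square \<open>1 + r^2 - 2 r cos (t - a)\<close>. After an
  exchange of integrals this allows integration over the angle of the inner point.\<close>

lemma poisson_kernel_symmetric:
  "poisson_kernel (rcis r a) t = poisson_kernel (rcis r t) a"
proof -
  have "norm (cis t - rcis r a) = norm (cis a - rcis r t)"
  proof -
    have "(norm (cis t - rcis r a))\<^sup>2 = (norm (cis a - rcis r t))\<^sup>2"
    proof -
      have "(cos t)\<^sup>2 + (sin t)\<^sup>2 = 1" "(cos a)\<^sup>2 + (sin a)\<^sup>2 = 1" by simp_all
      then have "(cos t - r * cos a)\<^sup>2 + (sin t - r * sin a)\<^sup>2
          = (cos a - r * cos t)\<^sup>2 + (sin a - r * sin t)\<^sup>2"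
        by algebra
      then show ?thesis by (simp add: cmod_power2)
    qed
    then show ?thesis by simp
  qed
  then show ?thesis by (simp add: poisson_kernel_def)
qed

text \<open>Cauchy's formula at \<open>z\<close>, applied not to \<open>h\<close> but to its product
  with \<open>(1 - |z|^2) / (1 - cnj z * w)\<close>. This factor is 1 at \<open>w = z\<close>, has
  no pole in the closed disk, and on the circle turns the Cauchy kernel into the Poisson
  kernel.\<close>

lemma poisson_formula_closed:
  fixes h :: "complex \<Rightarrow> complex"
  assumes c: "continuous_on (cball 0 1) h" and h: "h holomorphic_on ball 0 1" and z: "norm z < 1"
  shows "h z = 1 / (2 * pi) * (LINT t|circle_measure. poisson_kernel z t * h (cis t))"
proof -
  define k where "k w = h w * ((1 - (norm z)\<^sup>2) / (1 - cnj z * w))" for w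
  have nz: "1 - cnj z * w \<noteq> 0" if "norm w \<le> 1" for w
  proof
    assume "1 - cnj z * w = 0"
    then have "norm z * norm w = 1"
      by (metis complex_mod_cnj eq_iff_diff_eq_0 norm_mult norm_one)
    moreover have "norm z * norm w \<le> norm z * 1" using that by (intro mult_left_mono) auto
    ultimately show False using z by simp
  qed
  have kc: "continuous_on (cball 0 1) k"
    unfolding k_def by (intro continuous_intros c) (use nz in auto)
  have kh: "k holomorphic_on ball 0 1"
    unfolding k_def by (intro holomorphic_intros h) (use nz in auto)
  have "((\<lambda>u. k u / (u - z)) has_contour_integral (2 * of_real pi * \<i> * k z)) (circlepath 0 1)"
    by (rule Cauchy_integral_circlepath[OF kc kh]) (use z in simp)
  then have "((\<lambda>t. k (cis t) / (cis t - z) * \<i> * cis t) has_integral (2 * of_real pi * \<i> * k z)) {0..2*pi}"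
    unfolding circlepath_def by (subst (asm) has_contour_integral_part_circlepath_iff) auto
  then have 1: "integral {0..2*pi} (\<lambda>t. k (cis t) / (cis t - z) * \<i> * cis t) = 2 * of_real pi * \<i> * k z"
    by (rule integral_unique)
  have eq: "k (cis t) / (cis t - z) * \<i> * cis t = \<i> * (poisson_kernel z t * h (cis t))" for t
  proof -
    have ne: "cis t \<noteq> z" using z cis_neq_inside by blast
    have cc: "cis t * cnj (cis t) = 1" by (simp add: cis_cnj cis_mult)
    have "cis t * ((cis t - z) * cnj (cis t - z)) = (cis t - z) * (cis t * cnj (cis t) - cnj z * cis t)"
      unfolding complex_cnj_diff by (simp only: algebra_simps)
    then have "(cis t - z) * (1 - cnj z * cis t) = cis t * ((cis t - z) * cnj (cis t - z))"
      unfolding cc by (rule sym)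
    also have "\<dots> = cis t * (norm (cis t - z))\<^sup>2" unfolding complex_norm_square ..
    finally have *: "(cis t - z) * (1 - cnj z * cis t) = cis t * (norm (cis t - z))\<^sup>2" .
    have "k (cis t) / (cis t - z) * \<i> * cis t
        = \<i> * h (cis t) * (1 - (norm z)\<^sup>2) * cis t / ((cis t - z) * (1 - cnj z * cis t))"
      by (simp add: k_def field_simps)
    also have "\<dots> = \<i> * (poisson_kernel z t * h (cis t))"
      unfolding * using ne by (simp add: poisson_kernel_def field_simps)
    finally show ?thesis .
  qed
  have kz: "k z = h z"
    using nz[of z] z complex_norm_square[of z] by (simp add: k_def mult.commute)
  have co: "continuous_on {0..2*pi} (\<lambda>t. poisson_kernel z t * h (cis t))"
    by (intro continuous_intros continuous_poisson_kernel z continuous_on_compose2[OF c]) auto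
  have "(LINT t|circle_measure. poisson_kernel z t * h (cis t))
      = integral {0..2*pi} (\<lambda>t. poisson_kernel z t * h (cis t))"
    by (intro lebesgue_integral_eq_integral continuous_integrable_circle co) auto
  moreover have "\<i> * integral {0..2*pi} (\<lambda>t. poisson_kernel z t * h (cis t)) = 2 * of_real pi * \<i> * h z"
    using 1 unfolding eq kz by simp
  ultimately show ?thesis by simp
qed

lemma integral_poisson_kernel:
  assumes "norm z < 1"
  shows "(LINT t|circle_measure. poisson_kernel z t) = 2 * pi"
proof -
  have "1 = 1 / (2 * pi) * (LINT t|circle_measure. complex_of_real (poisson_kernel z t))"
    using poisson_formula_closed[of "\<lambda>_. 1" z] assms by simp
  also have "\<dots> = complex_of_real (1 / (2 * pi) * (LINT t|circle_measure. poisson_kernel z t))"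
    by simp
  finally have "1 / (2 * pi) * (LINT t|circle_measure. poisson_kernel z t) = 1"
    by (metis of_real_eq_1_iff)
  then show ?thesis by (simp add: field_simps)
qed

lemma continuous_on_circle_compose:
  assumes "f holomorphic_on ball 0 1" "0 \<le> r" "r < 1"
  shows "continuous_on A (\<lambda>t. f (rcis r t))"
  by (rule continuous_on_compose2[OF holomorphic_on_imp_continuous_on[OF assms(1)]])
     (use assms in \<open>auto simp: rcis_def norm_mult intro!: continuous_intros\<close>)

lemma poisson_formula:
  fixes h :: "complex \<Rightarrow> complex"
  assumes h: "h holomorphic_on ball 0 1" and z: "norm z < 1" and r: "0 \<le> r" "r < 1"
  shows "h (r * z) = 1 / (2 * pi) * (LINT t|circle_measure. poisson_kernel z t * h (rcis r t))"
proof -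
  have sub: "(\<lambda>w. of_real r * w) ` cball 0 1 \<subseteq> ball (0::complex) 1"
  proof clarsimp
    fix w :: complex assume "norm w \<le> 1"
    then have "r * norm w \<le> r * 1" using r by (intro mult_left_mono) auto
    then show "norm (of_real r * w) < 1" using r by (simp add: norm_mult)
  qed
  have c: "continuous_on (cball 0 1) (\<lambda>w. h (of_real r * w))"
    using sub by (intro continuous_on_compose2[OF holomorphic_on_imp_continuous_on[OF h]] continuous_intros)
  have "(h \<circ> (\<lambda>w. of_real r * w)) holomorphic_on ball 0 1"
    by (rule holomorphic_on_compose_gen[OF _ h]) (use sub in \<open>auto simp: image_subset_iff intro!: holomorphic_intros\<close>)
  then have "(\<lambda>w. h (of_real r * w)) holomorphic_on ball 0 1" by (simp add: o_def)
  from poisson_formula_closed[OF c this z] show ?thesis by (simp add: rcis_def)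
qed

lemma borel_measurable_circleI: "f \<in> borel_measurable borel \<Longrightarrow> f \<in> borel_measurable circle_measure"
  by (intro measurable_restrict_space1 measurable_completion) simp

lemma cis_measurable [measurable]: "cis \<in> borel_measurable circle_measure"
  by (intro borel_measurable_circleI borel_measurable_continuous_onI continuous_intros)

lemma cnj_cis_measurable [measurable]: "(\<lambda>t. cnj (cis t)) \<in> borel_measurable circle_measure"
  by (intro borel_measurable_circleI borel_measurable_continuous_onI continuous_intros)

section \<open>Herglotz integrals\<close>

text \<open>The exponent in \<open>outer_function\<close>: an outer function is a unimodular
  constant times \<open>exp (herglotz (\<lambda>t. ln (k t)) z)\<close>. Additivity in
  \<open>\<phi>\<close> becomes factorisation of the outer function.\<close>

definition herglotz :: "(real \<Rightarrow> real) \<Rightarrow> complex \<Rightarrow> complex" where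
  "herglotz \<phi> z = 1 / (2 * pi) * (LINT t|circle_measure. (cis t + z) / (cis t - z) * complex_of_real (\<phi> t))"

lemma herglotz_kernel_bound:
  assumes "norm z < 1"
  shows "norm ((cis t + z) / (cis t - z)) \<le> 2 / (1 - norm z)"
  unfolding norm_divide
  using assms cis_diff_ge[of z t] norm_triangle_ineq[of "cis t" z]
  by (intro frac_le) auto

lemma herglotz_integrable:
  assumes "norm z < 1" and \<phi>: "integrable circle_measure \<phi>"
  shows "integrable circle_measure (\<lambda>t. (cis t + z) / (cis t - z) * complex_of_real (\<phi> t))"
proof (rule Bochner_Integration.integrable_bound)
  show "integrable circle_measure (\<lambda>t. 2 / (1 - norm z) * \<bar>\<phi> t\<bar>)" using \<phi> by simp
  have [measurable]: "\<phi> \<in> borel_measurable circle_measure" using \<phi> by auto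
  show "(\<lambda>t. (cis t + z) / (cis t - z) * complex_of_real (\<phi> t)) \<in> borel_measurable circle_measure"
    by measurable
  have "norm ((cis t + z) / (cis t - z) * complex_of_real (\<phi> t)) \<le> 2 / (1 - norm z) * \<bar>\<phi> t\<bar>" for t
    unfolding norm_mult using herglotz_kernel_bound[OF assms(1), of t] assms(1) by (intro mult_mono) auto
  then show "AE t in circle_measure. norm ((cis t + z) / (cis t - z) * complex_of_real (\<phi> t))
      \<le> norm (2 / (1 - norm z) * \<bar>\<phi> t\<bar>)"
    by (intro AE_I2) (smt (verit) real_norm_def)
qed

lemma poisson_kernel_Re_mult:
  assumes "norm z < 1"
  shows "Re ((cis t + z) / (cis t - z) * complex_of_real x) = poisson_kernel z t * x"
proof -
  have "Re (w * complex_of_real x) = Re w * x" for w by simp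
  then show ?thesis unfolding poisson_kernel_Re[OF assms, symmetric] .
qed

lemma poisson_integrable:
  assumes "norm z < 1" and \<phi>: "integrable circle_measure \<phi>"
  shows "integrable circle_measure (\<lambda>t. poisson_kernel z t * \<phi> t)"
proof -
  have "integrable circle_measure (\<lambda>t. Re ((cis t + z) / (cis t - z) * complex_of_real (\<phi> t)))"
    by (intro integrable_Re herglotz_integrable assms)
  then show ?thesis by (simp only: poisson_kernel_Re_mult[OF assms(1)])
qed

lemma Re_herglotz:
  assumes "norm z < 1" and \<phi>: "integrable circle_measure \<phi>"
  shows "Re (herglotz \<phi> z) = 1 / (2 * pi) * (LINT t|circle_measure. poisson_kernel z t * \<phi> t)"
proof -
  have "Re (LINT t|circle_measure. (cis t + z) / (cis t - z) * complex_of_real (\<phi> t))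
      = (LINT t|circle_measure. Re ((cis t + z) / (cis t - z) * complex_of_real (\<phi> t)))"
    by (rule integral_Re[symmetric, OF herglotz_integrable[OF assms]])
  also have "\<dots> = (LINT t|circle_measure. poisson_kernel z t * \<phi> t)"
    by (simp only: poisson_kernel_Re_mult[OF assms(1)])
  finally show ?thesis by (simp add: herglotz_def)
qed

lemma Re_herglotz_le:
  assumes "norm z < 1" and \<phi>: "integrable circle_measure \<phi>" and le: "\<And>t. \<phi> t \<le> c"
  shows "Re (herglotz \<phi> z) \<le> c"
proof -
  have "(LINT t|circle_measure. poisson_kernel z t * \<phi> t) \<le> (LINT t|circle_measure. poisson_kernel z t * c)"
    using le poisson_kernel_nonneg[OF assms(1)] assms
    by (intro integral_mono poisson_integrable mult_left_mono) auto
  also have "\<dots> = 2 * pi * c" using integral_poisson_kernel[OF assms(1)] by simp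
  finally show ?thesis unfolding Re_herglotz[OF assms(1,2)] by (simp add: field_simps)
qed

lemma herglotz_add:
  assumes "norm z < 1" "integrable circle_measure \<phi>" "integrable circle_measure \<psi>"
  shows "herglotz (\<lambda>t. \<phi> t + \<psi> t) z = herglotz \<phi> z + herglotz \<psi> z"
  using herglotz_integrable[OF assms(1,2)] herglotz_integrable[OF assms(1,3)]
  by (simp add: herglotz_def distrib_left)

text \<open>The kernel equals \<open>2 / (1 - z * cnj (cis t)) - 1\<close>. Its geometric series may
  be integrated term by term, which exhibits the integral as a power series converging on the
  disk.\<close>

lemma herglotz_holomorphic:
  assumes \<phi>: "integrable circle_measure \<phi>"
  shows "herglotz \<phi> holomorphic_on ball 0 1"
proof -
  have m[measurable]: "\<phi> \<in> borel_measurable circle_measure" using \<phi> by auto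
  define b where "b n = (LINT t|circle_measure. cnj (cis t) ^ n * complex_of_real (\<phi> t))" for n
  define C where "C z = (LINT t|circle_measure. complex_of_real (\<phi> t) / (1 - z * cnj (cis t)))" for z
  have lt: "norm (z * cnj (cis t)) < 1" if "norm z < 1" for z t
    using that by (simp add: norm_mult)
  have "(\<lambda>n. b n * z ^ n) sums C z" if z: "norm z < 1" for z
  proof -
    define h where "h n t = (z * cnj (cis t)) ^ n * complex_of_real (\<phi> t)" for n t
    have hb: "norm (h n t) = norm z ^ n * \<bar>\<phi> t\<bar>" for n t
      by (simp add: h_def norm_mult norm_power power_mult_distrib)
    have hint: "integrable circle_measure (h n)" for n
    proof (rule Bochner_Integration.integrable_bound[OF \<phi>])
      show "h n \<in> borel_measurable circle_measure" unfolding h_def by measurable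
      have "norm z ^ n * \<bar>\<phi> t\<bar> \<le> 1 * \<bar>\<phi> t\<bar>" for t
        using z by (intro mult_right_mono power_le_one) auto
      then show "AE t in circle_measure. norm (h n t) \<le> norm (\<phi> t)" unfolding hb by simp
    qed
    have "(\<lambda>n. LINT t|circle_measure. h n t) sums (LINT t|circle_measure. (\<Sum>n. h n t))"
    proof (rule sums_integral[OF hint])
      show "AE t in circle_measure. summable (\<lambda>n. norm (h n t))"
        unfolding hb using z by (intro AE_I2 summable_mult2 summable_geometric) simp
      show "summable (\<lambda>n. LINT t|circle_measure. norm (h n t))"
        unfolding hb using z by (simp add: summable_mult2 summable_geometric)
    qed
    moreover have "(\<Sum>n. h n t) = complex_of_real (\<phi> t) / (1 - z * cnj (cis t))" for t
    proof -
      have "h n t = (z * cnj (cis t)) ^ n * complex_of_real (\<phi> t)" for n by (simp add: h_def)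
      moreover have "(\<lambda>n. (z * cnj (cis t)) ^ n * complex_of_real (\<phi> t)) sums
          (1 / (1 - z * cnj (cis t)) * complex_of_real (\<phi> t))"
        by (intro sums_mult2 geometric_sums lt z)
      ultimately show ?thesis by (simp add: sums_iff)
    qed
    moreover have "(LINT t|circle_measure. h n t) = b n * z ^ n" for n
    proof -
      have "h n t = z ^ n * (cnj (cis t) ^ n * complex_of_real (\<phi> t))" for t
        by (simp add: h_def power_mult_distrib)
      then show ?thesis by (simp add: b_def)
    qed
    ultimately show ?thesis by (simp add: C_def)
  qed
  then have C: "C holomorphic_on ball 0 1"
    by (intro power_series_holomorphic[where a=b]) simp
  have "herglotz \<phi> z = 1 / (2 * pi) * (2 * C z - (LINT t|circle_measure. complex_of_real (\<phi> t)))"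
    if z: "norm z < 1" for z
  proof -
    have eq: "(cis t + z) / (cis t - z) = 2 / (1 - z * cnj (cis t)) - 1" for t
    proof -
      have a: "1 - z * cnj (cis t) \<noteq> 0" using lt[OF z, of t] by force
      have "cis t * (1 - z * cnj (cis t)) = cis t - z * (cis t * cnj (cis t))" by (simp only: algebra_simps mult_1_left mult_1_right)
      also have "cis t * cnj (cis t) = 1" by (simp add: cis_cnj cis_mult)
      finally have d: "cis t - z = cis t * (1 - z * cnj (cis t))" by simp
      have "cis t * (1 + z * cnj (cis t)) = cis t + z * (cis t * cnj (cis t))" by (simp only: algebra_simps mult_1_left mult_1_right)
      also have "cis t * cnj (cis t) = 1" by (simp add: cis_cnj cis_mult)
      finally have n: "cis t + z = cis t * (1 + z * cnj (cis t))" by simp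
      show ?thesis unfolding d n using a by (simp add: field_simps)
    qed
    have i1: "integrable circle_measure (\<lambda>t. (cis t + z) / (cis t - z) * complex_of_real (\<phi> t))"
      by (rule herglotz_integrable[OF z \<phi>])
    have "integrable circle_measure (\<lambda>t. 1/2 * ((cis t + z) / (cis t - z) * complex_of_real (\<phi> t)
        + complex_of_real (\<phi> t)))"
      using i1 \<phi> by (intro integrable_mult_right Bochner_Integration.integrable_add) auto
    then have i2: "integrable circle_measure (\<lambda>t. complex_of_real (\<phi> t) / (1 - z * cnj (cis t)))"
      unfolding eq by (simp add: algebra_simps)
    have "(LINT t|circle_measure. (cis t + z) / (cis t - z) * complex_of_real (\<phi> t))
       = (LINT t|circle_measure. 2 * (complex_of_real (\<phi> t) / (1 - z * cnj (cis t))) - complex_of_real (\<phi> t))"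
      unfolding eq by (simp add: algebra_simps)
    also have "\<dots> = 2 * C z - (LINT t|circle_measure. complex_of_real (\<phi> t))"
      unfolding C_def
      by (subst Bochner_Integration.integral_diff[OF integrable_mult_right[OF i2]])
         (use \<phi> in \<open>auto simp only: integral_mult_right_zero integrable_of_real\<close>)
    finally show ?thesis by (simp add: herglotz_def)
  qed
  moreover have "(\<lambda>z. 1 / (2 * pi) * (2 * C z - (LINT t|circle_measure. complex_of_real (\<phi> t))))
      holomorphic_on ball 0 1"
    by (intro holomorphic_intros C)
  ultimately show ?thesis
    by (subst holomorphic_cong[OF refl]) auto
qed

lemma herglotz_tendsto_0:
  assumes z: "norm z < 1" and \<phi>: "\<And>n. integrable circle_measure (\<phi> n)"
    and w: "integrable circle_measure w" and b: "\<And>n t. \<bar>\<phi> n t\<bar> \<le> w t"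
    and lim: "\<And>t. (\<lambda>n. \<phi> n t) \<longlonglongrightarrow> 0"
  shows "(\<lambda>n. herglotz (\<phi> n) z) \<longlonglongrightarrow> 0"
proof -
  have "(\<lambda>n. LINT t|circle_measure. (cis t + z) / (cis t - z) * complex_of_real (\<phi> n t))
      \<longlonglongrightarrow> (LINT t|circle_measure. (cis t + z) / (cis t - z) * complex_of_real 0)"
  proof (rule integral_dominated_convergence[where w="\<lambda>t. 2 / (1 - norm z) * w t"])
    show "AE t in circle_measure. (\<lambda>n. (cis t + z) / (cis t - z) * complex_of_real (\<phi> n t))
        \<longlonglongrightarrow> (cis t + z) / (cis t - z) * complex_of_real 0"
      by (intro AE_I2 tendsto_intros lim)
    have "norm ((cis t + z) / (cis t - z) * complex_of_real (\<phi> n t)) \<le> 2 / (1 - norm z) * w t" for t n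
      unfolding norm_mult using herglotz_kernel_bound[OF z, of t] b[of n t] z
      by (intro mult_mono) auto
    then show "AE t in circle_measure. norm ((cis t + z) / (cis t - z) * complex_of_real (\<phi> n t))
        \<le> 2 / (1 - norm z) * w t" for n
      by simp
  qed (use w herglotz_integrable[OF z \<phi>] in auto)
  then have "(\<lambda>n. 1 / (2 * pi) * (LINT t|circle_measure. (cis t + z) / (cis t - z) * complex_of_real (\<phi> n t)))
      \<longlonglongrightarrow> complex_of_real (1 / (2 * pi)) * 0"
    by (intro tendsto_mult tendsto_const) simp
  then show ?thesis by (simp add: herglotz_def)
qed

section \<open>Poisson domination in Hardy spaces\<close>

text \<open>Dominated convergence and Fatou's lemma are applied along sequences, so radial limits
  are taken along this one. The shift by 2 keeps every radius positive, which is needed when its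
  logarithm is used as a coordinate.\<close>

definition radius :: "nat \<Rightarrow> real" where
  "radius j = 1 - 1 / (real j + 2)"

lemma radius_bounds [simp]: "0 \<le> radius j" "radius j < 1" "0 < radius j"
  by (auto simp: radius_def divide_simps)

lemma radius_tendsto: "radius \<longlonglongrightarrow> 1"
proof -
  have "(\<lambda>j. 1 - 1 / (real j + 2)) \<longlonglongrightarrow> 1 - 0"
    by (intro tendsto_intros tendsto_divide_0[OF tendsto_const] filterlim_at_top_imp_at_infinity
        filterlim_tendsto_add_at_top[OF tendsto_const, of _ _ 2, simplified add.commute] filterlim_real_sequentially)
  then show ?thesis by (simp add: radius_def[abs_def])
qed

lemma filterlim_radius: "filterlim radius (at_left 1) sequentially"
  unfolding filterlim_at using radius_tendsto by (simp add: less_imp_neq)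

lemma has_boundary_value_radius:
  "has_boundary_value f t w \<Longrightarrow> (\<lambda>j. f (rcis (radius j) t)) \<longlonglongrightarrow> w"
  unfolding has_boundary_value_def by (rule filterlim_compose[OF _ filterlim_radius])

lemma hardy_space_iff:
  "f \<in> hardy_space p \<longleftrightarrow> f holomorphic_on ball 0 1 \<and>
    (\<exists>B\<ge>0. \<forall>r. 0 \<le> r \<longrightarrow> r < 1 \<longrightarrow> (LINT t|circle_measure. norm (f (rcis r t)) powr p) \<le> B)"
proof -
  have "(\<exists>M. \<forall>r. 0 \<le> r \<longrightarrow> r < 1 \<longrightarrow> h r \<le> M) \<longleftrightarrow> (\<exists>B\<ge>0. \<forall>r. 0 \<le> r \<longrightarrow> r < 1 \<longrightarrow> h r \<le> B)"
    for h :: "real \<Rightarrow> real"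
    by (meson max.cobounded1 max.cobounded2 order_trans)
  from this[of "\<lambda>r. LINT t|circle_measure. norm (f (rcis r t)) powr p"] show ?thesis
    unfolding hardy_space_def bdd_above_def mem_Collect_eq ball_simps by (simp add: Ball_def imp_conjL)
qed

lemma integrable_circle_powr:
  assumes "f holomorphic_on ball 0 1" "0 \<le> r" "r < 1" "0 < p"
  shows "integrable circle_measure (\<lambda>t. norm (f (rcis r t)) powr p)"
  by (intro continuous_integrable_circle continuous_intros continuous_on_powr'
      continuous_on_circle_compose assms) (use assms in auto)

lemma measurable_circle_compose:
  assumes "f holomorphic_on ball 0 1" "0 \<le> r" "r < 1"
  shows "(\<lambda>t. f (rcis r t)) \<in> borel_measurable circle_measure"
  by (intro borel_measurable_integrable continuous_integrable_circle continuous_on_circle_compose assms)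

text \<open>The outer function is split at height \<open>-n\<close> of its logarithmic modulus: this yields bounded
  outer multipliers \<open>u\<close> of modulus at most \<open>1\<close> for which \<open>f u\<close> is a bounded multiple of \<open>f g\<close>,
  and hence in \<open>H\<^sup>p\<close>, while \<open>u\<close> tends to \<open>1\<close> as \<open>n\<close> grows.\<close>

lemma outer_multiplier_poisson_bound:
  assumes p: "1 < p" and f: "f holomorphic_on ball 0 1" and g: "outer_function g"
    and fg: "(\<lambda>z. f z * g z) \<in> hardy_space p"
    and lim: "AE t in circle_measure. (\<lambda>j. norm (f (rcis (radius j) t))) \<longlonglongrightarrow> \<phi> t"
    and \<phi>: "integrable circle_measure \<phi>"
    and z: "norm z < 1"
  shows "norm (f z) \<le> 1 / (2 * pi) * (LINT t|circle_measure. poisson_kernel z t * \<phi> t)"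
proof -
  obtain c k where c: "norm c = 1" and k: "k \<in> borel_measurable circle_measure" "\<And>t. 0 < k t"
    and lk: "integrable circle_measure (\<lambda>t. ln (k t))"
    and geq: "\<And>z. z \<in> ball 0 1 \<Longrightarrow> g z = c * exp (1 / (2 * pi) *
         (LINT t|circle_measure. (cis t + z) / (cis t - z) * complex_of_real (ln (k t))))"
    using g unfolding outer_function_def by blast
  define a where "a t = ln (k t)" for t
  have a: "integrable circle_measure a" using lk by (simp add: a_def[abs_def])
  have ga: "g z = c * exp (herglotz a z)" if "norm z < 1" for z
    using geq[of z] that by (simp add: herglotz_def a_def)
  define lo hi where "lo n t = min 0 (a t + real n)" and "hi n t = max (a t) (- real n)" for n t
  have lo: "integrable circle_measure (lo n)" for n
    by (rule Bochner_Integration.integrable_bound[OF a]) (use a in \<open>auto simp: lo_def[abs_def] abs_if\<close>)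
  have hi: "integrable circle_measure (hi n)" for n
    unfolding hi_def using a by (intro integrable_max) auto
  have lohi: "a = (\<lambda>t. lo n t + hi n t)" for n by (auto simp: lo_def hi_def)
  define u where "u n z = exp (herglotz (lo n) z)" for n z
  have u_hol: "u n holomorphic_on ball 0 1" for n
    unfolding u_def by (intro holomorphic_intros herglotz_holomorphic lo)
  have u_le: "norm (u n w) \<le> 1" if "norm w < 1" for n w
    using Re_herglotz_le[OF that lo, of n 0] by (simp add: u_def lo_def)
  \<comment> \<open>As \<open>hi n\<close> is at least \<open>- n\<close>, so is its Poisson
    integral. The factor of \<open>g\<close> that \<open>u n\<close> lacks therefore has modulus at
    least \<open>exp (- n)\<close>.\<close>
  have u_g: "norm (u n w) \<le> exp (real n) * norm (g w)" if w: "norm w < 1" for n w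
  proof -
    have "norm (g w) = exp (Re (herglotz (lo n) w)) * exp (Re (herglotz (hi n) w))"
      using ga[OF w] c lohi[of n] herglotz_add[OF w lo hi, of n n] by (simp add: norm_mult exp_add)
    moreover have "Re (herglotz (\<lambda>t. - hi n t) w) \<le> real n"
      by (rule Re_herglotz_le[OF w integrable_minus[OF hi]]) (simp add: hi_def)
    then have "- Re (herglotz (hi n) w) \<le> real n"
      by (simp add: herglotz_def)
    then have "1 \<le> exp (real n) * exp (Re (herglotz (hi n) w))"
      by (simp add: exp_add[symmetric])
    then have "norm (u n w) * 1 \<le> norm (u n w) * (exp (real n) * exp (Re (herglotz (hi n) w)))"
      by (intro mult_left_mono) auto
    ultimately show ?thesis by (simp add: u_def mult_ac)
  qed
  obtain B where B: "0 \<le> B" "\<And>r. 0 \<le> r \<Longrightarrow> r < 1 \<Longrightarrow>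
      (LINT t|circle_measure. norm (f (rcis r t) * g (rcis r t)) powr p) \<le> B"
    and fgh: "(\<lambda>z. f z * g z) holomorphic_on ball 0 1"
    using fg unfolding hardy_space_iff by auto
  let ?R = "1 / (2 * pi) * (LINT t|circle_measure. poisson_kernel z t * \<phi> t)"
  have bound: "norm (f z * u n z) \<le> ?R" for n
  proof -
    define h where "h w = f w * u n w" for w
    have h: "h holomorphic_on ball 0 1" unfolding h_def by (intro holomorphic_intros f u_hol)
    have hf: "norm (h w) \<le> norm (f w)" if "norm w < 1" for w
      using mult_left_mono[OF u_le[OF that, of n], of "norm (f w)"] by (simp add: h_def norm_mult)
    have hfg: "norm (h w) powr p \<le> exp (real n) powr p * norm (f w * g w) powr p" if "norm w < 1" for w
    proof -
      have "norm (h w) \<le> exp (real n) * norm (f w * g w)"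
        using mult_left_mono[OF u_g[OF that, of n], of "norm (f w)"] by (simp add: h_def norm_mult mult_ac)
      then have "norm (h w) powr p \<le> (exp (real n) * norm (f w * g w)) powr p"
        using p by (intro powr_mono2) auto
      also have "\<dots> = exp (real n) powr p * norm (f w * g w) powr p"
        by (rule powr_mult) 
      finally show ?thesis .
    qed
    \<comment> \<open>Only an upper bound is wanted, so the excess over \<open>\<phi>\<close> is
      enough. Since \<open>\<phi>\<close> is nonnegative almost everywhere, the excess is at most
      \<open>norm h\<close> and inherits the \<open>L\<^sup>p\<close> bound of \<open>f g\<close>,
      although \<open>\<phi>\<close> itself is only known to be integrable. It tends to 0 because
      \<open>norm h\<close> is at most \<open>norm f\<close>.\<close>
    define X where "X j t = max 0 (norm (h (rcis (radius j) t)) - \<phi> t)" for j t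
    have [measurable]: "\<phi> \<in> borel_measurable circle_measure" using \<phi> by auto
    have [measurable]: "(\<lambda>t. h (rcis (radius j) t)) \<in> borel_measurable circle_measure" for j
      by (intro measurable_circle_compose h) auto
    have Xm[measurable]: "X j \<in> borel_measurable circle_measure" for j unfolding X_def by measurable
    have ih: "integrable circle_measure (\<lambda>t. norm (h (rcis (radius j) t)))" for j
      by (intro continuous_integrable_circle continuous_intros continuous_on_circle_compose h) auto
    have ihp: "integrable circle_measure (\<lambda>t. norm (h (rcis (radius j) t)) powr p)" for j
      using p by (intro integrable_circle_powr h) auto
    have nnphi: "AE t in circle_measure. 0 \<le> \<phi> t"
      using lim
    proof eventually_elim
      case (elim t) then show ?case by (rule LIMSEQ_le_const) auto
    qed
    have Xp: "AE t in circle_measure. X j t powr p \<le> norm (h (rcis (radius j) t)) powr p" for j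
      using nnphi
    proof eventually_elim
      case (elim t)
      then show ?case using p by (intro powr_mono2) (auto simp: X_def)
    qed
    have iXp: "integrable circle_measure (\<lambda>t. X j t powr p)" for j
      by (rule Bochner_Integration.integrable_bound[OF ihp[of j]]) (use Xp[of j] in auto)
    have "(\<lambda>j. LINT t|circle_measure. X j t) \<longlonglongrightarrow> 0"
    proof (rule circle.integral_tendsto_0_of_Lp_bounded[OF p Xm _ _ iXp])
      show "AE t in circle_measure. (\<lambda>j. X j t) \<longlonglongrightarrow> 0"
        using lim
      proof eventually_elim
        case (elim t)
        have "(\<lambda>j. \<bar>norm (f (rcis (radius j) t)) - \<phi> t\<bar>) \<longlonglongrightarrow> \<bar>\<phi> t - \<phi> t\<bar>"
          by (intro tendsto_intros elim)
        then have "(\<lambda>j. \<bar>norm (f (rcis (radius j) t)) - \<phi> t\<bar>) \<longlonglongrightarrow> 0" by simp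
        then show ?case
        proof (rule Lim_null_comparison[rotated])
          have "norm (X j t) \<le> \<bar>norm (f (rcis (radius j) t)) - \<phi> t\<bar>" for j
            using hf[of "rcis (radius j) t"] by (auto simp: X_def)
          then show "\<forall>\<^sub>F j in sequentially. norm (X j t) \<le> \<bar>norm (f (rcis (radius j) t)) - \<phi> t\<bar>"
            by simp
        qed
      qed
      show "(LINT t|circle_measure. X j t powr p) \<le> exp (real n) powr p * B" for j
      proof -
        have "(LINT t|circle_measure. X j t powr p)
            \<le> (LINT t|circle_measure. exp (real n) powr p * norm (f (rcis (radius j) t) * g (rcis (radius j) t)) powr p)"
        proof (rule integral_mono_AE[OF iXp])
          show "integrable circle_measure (\<lambda>t. exp (real n) powr p * norm (f (rcis (radius j) t) * g (rcis (radius j) t)) powr p)"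
            using integrable_circle_powr[OF fgh, of "radius j" p] p by (intro integrable_mult_right) auto
          show "AE t in circle_measure. X j t powr p
              \<le> exp (real n) powr p * norm (f (rcis (radius j) t) * g (rcis (radius j) t)) powr p"
            using Xp[of j]
          proof eventually_elim
            case (elim t)
            then show ?case using hfg[of "rcis (radius j) t"] by simp
          qed
        qed
        also have "\<dots> \<le> exp (real n) powr p * B" by (simp add: B(2))
        finally show ?thesis .
      qed
    qed (auto simp: X_def)
    then have "(\<lambda>j. ?R + 1 / (2 * pi) * (2 / (1 - norm z) * (LINT t|circle_measure. X j t)))
        \<longlonglongrightarrow> ?R + 1 / (2 * pi) * (2 / (1 - norm z) * 0)"
      by (intro tendsto_intros)
    \<comment> \<open>In \<open>\<phi> + X j\<close> the first summand stays under the kernel. For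
      the second the maximum \<open>2 / (1 - norm z)\<close> of the kernel is good enough, since the
      mean of \<open>X j\<close> tends to 0.\<close>
    moreover have "norm (h (radius j * z)) \<le> ?R + 1 / (2 * pi) * (2 / (1 - norm z) * (LINT t|circle_measure. X j t))" for j
    proof -
      have iX: "integrable circle_measure (X j)"
        using circle.integrable_of_powr[OF _ Xm, of p j] iXp[of j] p by (simp add: X_def)
      have "norm (h (radius j * z))
          = 1 / (2 * pi) * norm (LINT t|circle_measure. poisson_kernel z t * h (rcis (radius j) t))"
        by (subst poisson_formula[OF h z]) (auto simp: norm_mult norm_divide)
      also have "\<dots> \<le> 1 / (2 * pi) * (LINT t|circle_measure. norm (poisson_kernel z t * h (rcis (radius j) t)))"
        by (intro mult_left_mono integral_norm_bound) auto
      also have "\<dots> \<le> 1 / (2 * pi) * (LINT t|circle_measure. poisson_kernel z t * \<phi> t + 2 / (1 - norm z) * X j t)"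
      proof (intro mult_left_mono integral_mono)
        show "integrable circle_measure (\<lambda>t. norm (poisson_kernel z t * h (rcis (radius j) t)))"
          using poisson_integrable[OF z ih[of j]] poisson_kernel_nonneg[OF z] by (simp add: norm_mult)
        show "integrable circle_measure (\<lambda>t. poisson_kernel z t * \<phi> t + 2 / (1 - norm z) * X j t)"
          using poisson_integrable[OF z \<phi>] iX by auto
        show "norm (poisson_kernel z t * h (rcis (radius j) t))
            \<le> poisson_kernel z t * \<phi> t + 2 / (1 - norm z) * X j t" for t
        proof -
          have "norm (poisson_kernel z t * h (rcis (radius j) t))
              = poisson_kernel z t * norm (h (rcis (radius j) t))"
            using poisson_kernel_nonneg[OF z] by (simp add: norm_mult)
          also have "\<dots> \<le> poisson_kernel z t * (\<phi> t + X j t)"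
            using poisson_kernel_nonneg[OF z] by (intro mult_left_mono) (auto simp: X_def)
          also have "\<dots> \<le> poisson_kernel z t * \<phi> t + 2 / (1 - norm z) * X j t"
            unfolding distrib_left using poisson_kernel_le[OF z, of t]
            by (intro add_left_mono mult_right_mono) (auto simp: X_def)
          finally show ?thesis .
        qed
      qed auto
      also have "\<dots> = ?R + 1 / (2 * pi) * (2 / (1 - norm z) * (LINT t|circle_measure. X j t))"
        using poisson_integrable[OF z \<phi>] iX by (simp add: distrib_left)
      finally show ?thesis .
    qed
    moreover have "(\<lambda>j. norm (h (radius j * z))) \<longlonglongrightarrow> norm (h z)"
    proof (intro tendsto_norm)
      have "isCont h z"
        using holomorphic_on_imp_continuous_on[OF h] z by (simp add: continuous_on_eq_continuous_at)
      moreover have "(\<lambda>j. complex_of_real (radius j) * z) \<longlonglongrightarrow> of_real 1 * z"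
        by (intro tendsto_intros radius_tendsto)
      ultimately show "(\<lambda>j. h (complex_of_real (radius j) * z)) \<longlonglongrightarrow> h z"
        by (intro isCont_tendsto_compose[of z h]) auto
    qed
    ultimately have "norm (h z) \<le> ?R + 1 / (2 * pi) * (2 / (1 - norm z) * 0)"
      by (intro LIMSEQ_le) auto
    then show ?thesis by (simp add: h_def)
  qed
  have "(\<lambda>n. herglotz (lo n) z) \<longlonglongrightarrow> 0"
  proof (rule herglotz_tendsto_0[OF z lo])
    show "integrable circle_measure (\<lambda>t. \<bar>a t\<bar>)" using a by simp
    show "\<bar>lo n t\<bar> \<le> \<bar>a t\<bar>" for n t by (auto simp: lo_def)
    show "(\<lambda>n. lo n t) \<longlonglongrightarrow> 0" for t
    proof (rule tendsto_eventually)
      obtain N where "- a t \<le> real N" using real_arch_simple by blast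
      then have "lo n t = 0" if "n \<ge> N" for n using that by (simp add: lo_def)
      then show "\<forall>\<^sub>F n in sequentially. lo n t = 0" by (auto simp: eventually_sequentially)
    qed
  qed
  then have "(\<lambda>n. norm (f z * exp (herglotz (lo n) z))) \<longlonglongrightarrow> norm (f z * exp 0)"
    by (intro tendsto_intros)
  then have "norm (f z * exp 0) \<le> ?R"
    by (rule LIMSEQ_le_const2) (use bound in \<open>auto simp: u_def\<close>)
  then show ?thesis by simp
qed

section \<open>Jensen's inequality for Poisson means and membership in Hardy spaces\<close>

lemma powr_above_tangent:
  fixes x m p :: real
  assumes "0 \<le> x" "0 < m" "1 \<le> p"
  shows "m powr p + p * m powr (p - 1) * (x - m) \<le> x powr p"
\<comment> \<open>The convexity argument runs on the open half-line \<open>{0<..}\<close>; at its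
  endpoint the tangent has the value \<open>(1 - p) * m powr p\<close>, which is not
  positive.\<close>
proof (cases "x = 0")
  case True
  have "m powr p = m powr (p - 1) * m"
    using powr_add[of m "p - 1" 1] assms by simp
  then have "m powr p + p * m powr (p - 1) * (x - m) = (1 - p) * m powr p"
    using True by (simp add: algebra_simps)
  also have "\<dots> \<le> 0" using assms by (intro mult_nonpos_nonneg) auto
  finally show ?thesis using True by simp
next
  case False
  have "x powr p - m powr p \<ge> p * m powr (p - 1) * (x - m)"
  proof (rule convex_on_imp_above_tangent[OF powr_convex])
    show "((\<lambda>x. x powr p) has_real_derivative p * m powr (p - 1)) (at m within {0<..})"
      using assms by (intro has_field_derivative_at_within[OF has_real_derivative_powr])
  qed (use assms False in \<open>auto simp: interior_open\<close>)
  then show ?thesis by simp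
qed

text \<open>\<open>poisson_kernel z t / (2 * pi)\<close> is a probability density. Integrating the
  tangent of \<open>x powr p\<close> at the mean \<open>m\<close> against it removes the linear term
  and leaves \<open>m powr p\<close>.\<close>

lemma poisson_jensen:
  assumes p: "1 \<le> p" and z: "norm z < 1" and nn: "\<And>t. 0 \<le> \<phi> t"
    and \<phi>: "integrable circle_measure \<phi>" and \<phi>p: "integrable circle_measure (\<lambda>t. \<phi> t powr p)"
  shows "(1 / (2 * pi) * (LINT t|circle_measure. poisson_kernel z t * \<phi> t)) powr p
    \<le> 1 / (2 * pi) * (LINT t|circle_measure. poisson_kernel z t * \<phi> t powr p)"
proof -
  define m where "m = 1 / (2 * pi) * (LINT t|circle_measure. poisson_kernel z t * \<phi> t)"
  have m0: "0 \<le> m" unfolding m_def using nn poisson_kernel_nonneg[OF z] by simp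
  show ?thesis
  proof (cases "m = 0")
    case True
    then show ?thesis unfolding m_def[symmetric] using nn poisson_kernel_nonneg[OF z] by simp
  next
    case False
    let ?P = "poisson_kernel z"
    have m: "(LINT t|circle_measure. ?P t * \<phi> t) = 2 * pi * m" by (simp add: m_def)
    have i0: "integrable circle_measure (\<lambda>t. ?P t * 1)" by (intro poisson_integrable z) auto
    have i1: "integrable circle_measure (\<lambda>t. ?P t * \<phi> t)" by (intro poisson_integrable z \<phi>)
    have i2: "integrable circle_measure (\<lambda>t. ?P t * \<phi> t powr p)" by (intro poisson_integrable z \<phi>p)
    have "(LINT t|circle_measure. (m powr p - p * m powr (p - 1) * m) * (?P t * 1)
          + p * m powr (p - 1) * (?P t * \<phi> t))
        \<le> (LINT t|circle_measure. ?P t * \<phi> t powr p)"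
    proof (intro integral_mono Bochner_Integration.integrable_add integrable_mult_right i0 i1 i2)
      fix t
      have "?P t * (m powr p + p * m powr (p - 1) * (\<phi> t - m)) \<le> ?P t * \<phi> t powr p"
        using powr_above_tangent[OF nn _ p, of m t] False m0 poisson_kernel_nonneg[OF z]
        by (intro mult_left_mono) auto
      then show "(m powr p - p * m powr (p - 1) * m) * (?P t * 1)
          + p * m powr (p - 1) * (?P t * \<phi> t) \<le> ?P t * \<phi> t powr p"
        by (simp add: algebra_simps)
    qed
    also have "(LINT t|circle_measure. (m powr p - p * m powr (p - 1) * m) * (?P t * 1)
          + p * m powr (p - 1) * (?P t * \<phi> t))
        = (m powr p - p * m powr (p - 1) * m) * (2 * pi) + p * m powr (p - 1) * (2 * pi * m)"
      unfolding m[symmetric] using i0 i1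
      by (subst Bochner_Integration.integral_add) (simp_all add: integral_poisson_kernel[OF z])
    also have "\<dots> = 2 * pi * m powr p" by (simp add: algebra_simps)
    finally show ?thesis unfolding m_def[symmetric] by (simp add: field_simps)
  qed
qed

text \<open>Poisson integration does not increase \<open>L\<^sup>p\<close> norms: Jensen's
  inequality at each point of the circle of radius \<open>r\<close>, then integration over that
  circle, where the kernel again has mass \<open>2 * pi\<close> by symmetry.\<close>

lemma hardy_space_of_poisson_bound:
  assumes p: "1 \<le> p" and f: "f holomorphic_on ball 0 1" and nn: "\<And>t. 0 \<le> \<phi> t"
    and \<phi>: "integrable circle_measure \<phi>" and \<phi>p: "integrable circle_measure (\<lambda>t. \<phi> t powr p)"
    and le: "\<And>z. norm z < 1 \<Longrightarrow>
      norm (f z) \<le> 1 / (2 * pi) * (LINT t|circle_measure. poisson_kernel z t * \<phi> t)"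
  shows "f \<in> hardy_space p"
  unfolding hardy_space_iff
proof (intro conjI f exI allI impI)
  show "0 \<le> (LINT t|circle_measure. \<phi> t powr p)" by simp
  fix r :: real assume r: "0 \<le> r" "r < 1"
  interpret pair_sigma_finite circle_measure circle_measure by (rule circle_pair_sigma_finite)
  have [measurable]: "\<phi> \<in> borel_measurable circle_measure" using \<phi> by auto
  have z: "norm (rcis r a) < 1" for a using r by simp
  have "ennreal (LINT a|circle_measure. norm (f (rcis r a)) powr p)
      = (\<integral>\<^sup>+a. ennreal (norm (f (rcis r a)) powr p) \<partial>circle_measure)"
    using p by (intro nn_integral_eq_integral[symmetric] integrable_circle_powr f r) auto
  also have "\<dots> \<le> (\<integral>\<^sup>+a. (\<integral>\<^sup>+t. ennreal (1 / (2 * pi) * (poisson_kernel (rcis r a) t * \<phi> t powr p))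
      \<partial>circle_measure) \<partial>circle_measure)"
  proof (rule nn_integral_mono)
    fix a
    have "norm (f (rcis r a)) powr p
        \<le> (1 / (2 * pi) * (LINT t|circle_measure. poisson_kernel (rcis r a) t * \<phi> t)) powr p"
      using p le[OF z] by (intro powr_mono2) auto
    also have "\<dots> \<le> 1 / (2 * pi) * (LINT t|circle_measure. poisson_kernel (rcis r a) t * \<phi> t powr p)"
      by (rule poisson_jensen[OF p z nn \<phi> \<phi>p])
    also have "\<dots> = (LINT t|circle_measure. 1 / (2 * pi) * (poisson_kernel (rcis r a) t * \<phi> t powr p))"
      by simp
    finally have "ennreal (norm (f (rcis r a)) powr p)
        \<le> ennreal (LINT t|circle_measure. 1 / (2 * pi) * (poisson_kernel (rcis r a) t * \<phi> t powr p))"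
      by (rule ennreal_leI)
    also have "\<dots> = (\<integral>\<^sup>+t. ennreal (1 / (2 * pi) * (poisson_kernel (rcis r a) t * \<phi> t powr p)) \<partial>circle_measure)"
      using poisson_kernel_nonneg[OF z]
      by (intro nn_integral_eq_integral[symmetric] integrable_mult_right poisson_integrable z \<phi>p) auto
    finally show "ennreal (norm (f (rcis r a)) powr p)
        \<le> (\<integral>\<^sup>+t. ennreal (1 / (2 * pi) * (poisson_kernel (rcis r a) t * \<phi> t powr p)) \<partial>circle_measure)" .
  qed
  \<comment> \<open>The estimate is carried out with nonnegative integrals so that the exchange
    requires measurability only.\<close>
  also have "\<dots> = (\<integral>\<^sup>+t. (\<integral>\<^sup>+a. ennreal (1 / (2 * pi) * (poisson_kernel (rcis r a) t * \<phi> t powr p))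
      \<partial>circle_measure) \<partial>circle_measure)"
    by (rule Fubini'[symmetric]) (unfold poisson_kernel_def rcis_def case_prod_beta, measurable)
  also have "\<dots> = (\<integral>\<^sup>+t. ennreal (\<phi> t powr p) \<partial>circle_measure)"
  proof (rule nn_integral_cong)
    fix t
    have i: "integrable circle_measure (poisson_kernel (rcis r t))"
      by (intro continuous_integrable_circle continuous_poisson_kernel z)
    have "(\<integral>\<^sup>+a. ennreal (1 / (2 * pi) * (poisson_kernel (rcis r a) t * \<phi> t powr p)) \<partial>circle_measure)
        = (\<integral>\<^sup>+a. ennreal (\<phi> t powr p / (2 * pi) * poisson_kernel (rcis r t) a) \<partial>circle_measure)"
      by (simp add: poisson_kernel_symmetric[of r _ t] mult_ac)
    also have "\<dots> = ennreal (LINT a|circle_measure. \<phi> t powr p / (2 * pi) * poisson_kernel (rcis r t) a)"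
      using poisson_kernel_nonneg[OF z] i
      by (intro nn_integral_eq_integral integrable_mult_right) auto
    also have "\<dots> = ennreal (\<phi> t powr p)" using integral_poisson_kernel[OF z] by simp
    finally show "(\<integral>\<^sup>+a. ennreal (1 / (2 * pi) * (poisson_kernel (rcis r a) t * \<phi> t powr p)) \<partial>circle_measure)
        = ennreal (\<phi> t powr p)" .
  qed
  also have "\<dots> = ennreal (LINT t|circle_measure. \<phi> t powr p)"
    by (intro nn_integral_eq_integral \<phi>p) auto
  finally show "(LINT t|circle_measure. norm (f (rcis r t)) powr p) \<le> (LINT t|circle_measure. \<phi> t powr p)"
    by (simp add: ennreal_le_iff)
qed

section \<open>Integrability of the boundary modulus\<close>

lemma Young_powr:
  fixes a b p r s :: real
  assumes "0 \<le> a" "0 \<le> b" "0 < p" "0 < s" "0 < r" and r: "1 / r = 1 / p + 1 / s"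
  shows "(a * b) powr r \<le> a powr p + b powr s"
proof -
  \<comment> \<open>With the larger of the two powers as \<open>m\<close>, the factors are at most
    \<open>m powr (1 / p)\<close> and \<open>m powr (1 / s)\<close>, so the product is at most
    \<open>m powr (1 / r)\<close>. This is a pointwise form of Hoelder's inequality, meant for
    \<open>f = (f g) * (1 / g)\<close>.\<close>
  define m where "m = max (a powr p) (b powr s)"
  have "a = (a powr p) powr (1 / p)" using assms by (simp add: powr_powr)
  also have "\<dots> \<le> m powr (1 / p)" using assms by (intro powr_mono2) (auto simp: m_def)
  finally have a: "a \<le> m powr (1 / p)" .
  have "b = (b powr s) powr (1 / s)" using assms by (simp add: powr_powr)
  also have "\<dots> \<le> m powr (1 / s)" using assms by (intro powr_mono2) (auto simp: m_def)
  finally have b: "b \<le> m powr (1 / s)" .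
  have "a * b \<le> m powr (1 / r)" unfolding r powr_add using a b assms by (intro mult_mono) auto
  then have "(a * b) powr r \<le> (m powr (1 / r)) powr r" using assms by (intro powr_mono2) auto
  also have "\<dots> = m" using \<open>0 < r\<close> by (simp add: powr_powr m_def max_def)
  also have "\<dots> \<le> a powr p + b powr s" by (simp add: m_def)
  finally show ?thesis .
qed

text \<open>Reads a lower limit from Fatou's lemma as a real bound. Finiteness is demanded because
  \<open>enn2real\<close> sends \<open>top\<close> to 0.\<close>

lemma limit_le_enn2real_liminf:
  fixes a b :: "nat \<Rightarrow> real"
  assumes "\<And>j. a j \<le> b j" "a \<longlonglongrightarrow> l" "liminf (\<lambda>j. ennreal (b j)) < top"
  shows "l \<le> enn2real (liminf (\<lambda>j. ennreal (b j)))"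
proof -
  have "ennreal l = liminf (\<lambda>j. ennreal (a j))"
    by (rule lim_imp_Liminf[symmetric]) (use assms(2) in \<open>auto intro: tendsto_ennrealI\<close>)
  also have "\<dots> \<le> liminf (\<lambda>j. ennreal (b j))"
    by (intro Liminf_mono always_eventually allI ennreal_leI assms(1))
  also have "\<dots> = ennreal (enn2real (liminf (\<lambda>j. ennreal (b j))))"
    using assms(3) by simp
  finally show ?thesis by (simp add: ennreal_le_iff)
qed

text \<open>Fatou's lemma for \<open>f g\<close> replaces the boundary function of \<open>f g\<close>, which need not be
  introduced.\<close>

lemma quotient_boundary_integrable:
  assumes p: "0 < p" and s: "0 < s" and r: "0 < r" "1 / r = 1 / p + 1 / s"
    and fg: "(\<lambda>z. f z * g z) \<in> hardy_space p" and g0: "\<And>z. norm z < 1 \<Longrightarrow> g z \<noteq> 0"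
    and \<delta>: "0 < \<delta>" and off: "AE t in circle_measure. cis t \<notin> \<Gamma> \<longrightarrow>
           (\<exists>w. has_boundary_value g t w \<and> \<delta> \<le> norm w)"
    and on: "boundary_in_Lp s \<Gamma> (\<lambda>z. 1 / g z)"
    and \<Gamma>: "\<Gamma> \<in> sets borel"
    and lim: "AE t in circle_measure. (\<lambda>j. f (rcis (radius j) t)) \<longlonglongrightarrow> fs t"
    and fs[measurable]: "fs \<in> borel_measurable circle_measure"
  shows "integrable circle_measure (\<lambda>t. indicator (- \<Gamma>) (cis t) * norm (fs t) powr p)"
    and "integrable circle_measure (\<lambda>t. norm (fs t) powr r)"
proof -
  obtain F where F[measurable]: "F \<in> borel_measurable circle_measure"
    and FG: "AE t in circle_measure. cis t \<in> \<Gamma> \<longrightarrow> has_boundary_value (\<lambda>z. 1 / g z) t (F t)"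
    and Fs: "integrable circle_measure (\<lambda>t. indicator \<Gamma> (cis t) * norm (F t) powr s)"
    using on unfolding boundary_in_Lp_def by blast
  obtain B where B: "0 \<le> B" "\<And>r. 0 \<le> r \<Longrightarrow> r < 1 \<Longrightarrow>
      (LINT t|circle_measure. norm (f (rcis r t) * g (rcis r t)) powr p) \<le> B"
    and fgh: "(\<lambda>z. f z * g z) holomorphic_on ball 0 1"
    using fg unfolding hardy_space_iff by auto
  have indm[measurable]: "(\<lambda>t. indicator \<Gamma> (cis t) :: real) \<in> borel_measurable circle_measure"
      "(\<lambda>t. indicator (- \<Gamma>) (cis t) :: real) \<in> borel_measurable circle_measure"
    using \<Gamma> by (auto intro!: measurable_compose[OF cis_measurable] borel_measurable_indicator)
  define b where "b j t = norm (f (rcis (radius j) t) * g (rcis (radius j) t)) powr p" for j t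
  define l where "l t = liminf (\<lambda>j. ennreal (b j t))" for t
  have bi: "integrable circle_measure (b j)" for j
    unfolding b_def using integrable_circle_powr[OF fgh, of "radius j" p] p by auto
  have bm[measurable]: "b j \<in> borel_measurable circle_measure" for j using bi by auto
  have lm[measurable]: "l \<in> borel_measurable circle_measure" unfolding l_def by measurable
  have "(\<integral>\<^sup>+t. l t \<partial>circle_measure) \<le> liminf (\<lambda>j. \<integral>\<^sup>+t. ennreal (b j t) \<partial>circle_measure)"
    unfolding l_def by (rule nn_integral_liminf) measurable
  also have "\<dots> \<le> liminf (\<lambda>j::nat. ennreal B)"
  proof (intro Liminf_mono always_eventually allI)
    fix j
    have "(\<integral>\<^sup>+t. ennreal (b j t) \<partial>circle_measure) = ennreal (LINT t|circle_measure. b j t)"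
      by (intro nn_integral_eq_integral bi) (auto simp: b_def)
    also have "\<dots> \<le> ennreal B" unfolding b_def by (intro ennreal_leI B) auto
    finally show "(\<integral>\<^sup>+t. ennreal (b j t) \<partial>circle_measure) \<le> ennreal B" .
  qed
  also have "\<dots> = ennreal B" by (simp add: Liminf_const)
  finally have lB: "(\<integral>\<^sup>+t. l t \<partial>circle_measure) \<le> ennreal B" .
  then have "(\<integral>\<^sup>+t. l t \<partial>circle_measure) \<noteq> \<infinity>" by (auto simp: top_unique)
  from nn_integral_PInf_AE[OF lm this] have l_fin: "AE t in circle_measure. l t < top"
    by (simp add: less_top)
  define L where "L t = enn2real (l t)" for t
  have [measurable]: "L \<in> borel_measurable circle_measure" unfolding L_def by measurable
  have L: "integrable circle_measure L"
  proof (rule integrableI_nonneg)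
    have "(\<integral>\<^sup>+t. ennreal (L t) \<partial>circle_measure) = (\<integral>\<^sup>+t. l t \<partial>circle_measure)"
      by (rule nn_integral_cong_AE) (use l_fin in \<open>auto simp: L_def\<close>)
    also have "\<dots> < \<infinity>" using lB by (auto simp: le_less_trans)
    finally show "(\<integral>\<^sup>+t. ennreal (L t) \<partial>circle_measure) < \<infinity>" .
  qed (auto simp: L_def)
  have L0: "0 \<le> L t" for t by (simp add: L_def)
  have offL: "AE t in circle_measure. cis t \<notin> \<Gamma> \<longrightarrow> norm (fs t) powr p \<le> L t / \<delta> powr p"
    using off lim l_fin
  proof eventually_elim
    case (elim t)
    show ?case
    proof
      assume "cis t \<notin> \<Gamma>"
      then obtain w where w: "has_boundary_value g t w" "\<delta> \<le> norm w" using elim by blast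
      have "(\<lambda>j. b j t) \<longlonglongrightarrow> norm (fs t * w) powr p"
        unfolding b_def using p
        by (intro tendsto_powr' tendsto_norm tendsto_mult elim has_boundary_value_radius[OF w(1)] tendsto_const) auto
      then have "norm (fs t * w) powr p \<le> L t"
        unfolding L_def l_def by (rule limit_le_enn2real_liminf[OF order_refl]) (use elim in \<open>simp add: l_def\<close>)
      moreover have "(norm (fs t) * \<delta>) powr p \<le> norm (fs t * w) powr p"
        unfolding norm_mult using w \<delta> p by (intro powr_mono2 mult_left_mono) auto
      ultimately have "norm (fs t) powr p * \<delta> powr p \<le> L t" using \<delta> by (simp add: powr_mult)
      then show "norm (fs t) powr p \<le> L t / \<delta> powr p" using \<delta> by (simp add: field_simps)
    qed
  qed
  have onL: "AE t in circle_measure. cis t \<in> \<Gamma> \<longrightarrow> norm (fs t) powr r \<le> L t + norm (F t) powr s"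
    using FG lim l_fin
  proof eventually_elim
    case (elim t)
    show ?case
    proof
      assume "cis t \<in> \<Gamma>"
      then have Ft: "(\<lambda>j. 1 / g (rcis (radius j) t)) \<longlonglongrightarrow> F t"
        using elim has_boundary_value_radius by blast
      \<comment> \<open>The limit \<open>F t\<close> of \<open>1 / g\<close> could be 0 here, so
        \<open>f g\<close> is not known to converge. Young's inequality is rearranged so that
        everything on the left converges and \<open>f g\<close> appears only in \<open>b j\<close>,
        of which the lower limit is taken.\<close>
      have "norm (f (rcis (radius j) t)) powr r - norm (1 / g (rcis (radius j) t)) powr s \<le> b j t" for j
      proof -
        have g: "g (rcis (radius j) t) \<noteq> 0" by (rule g0) simp
        have "norm (f (rcis (radius j) t))
            = norm (f (rcis (radius j) t) * g (rcis (radius j) t)) * norm (1 / g (rcis (radius j) t))"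
          using g by (simp add: norm_mult norm_divide)
        then have "norm (f (rcis (radius j) t)) powr r
            = (norm (f (rcis (radius j) t) * g (rcis (radius j) t)) * norm (1 / g (rcis (radius j) t))) powr r"
          by simp
        also have "\<dots> \<le> b j t + norm (1 / g (rcis (radius j) t)) powr s"
          unfolding b_def using Young_powr[OF _ _ p s r] norm_ge_zero by blast
        finally show ?thesis by simp
      qed
      moreover have "(\<lambda>j. norm (f (rcis (radius j) t)) powr r - norm (1 / g (rcis (radius j) t)) powr s)
          \<longlonglongrightarrow> norm (fs t) powr r - norm (F t) powr s"
        using r s by (intro tendsto_diff tendsto_powr' tendsto_norm elim Ft tendsto_const) auto
      ultimately have "norm (fs t) powr r - norm (F t) powr s \<le> L t"
        unfolding L_def l_def by (rule limit_le_enn2real_liminf) (use elim in \<open>simp add: l_def\<close>)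
      then show "norm (fs t) powr r \<le> L t + norm (F t) powr s" by simp
    qed
  qed
  show off_int: "integrable circle_measure (\<lambda>t. indicator (- \<Gamma>) (cis t) * norm (fs t) powr p)"
  proof (rule Bochner_Integration.integrable_bound)
    show "integrable circle_measure (\<lambda>t. L t / \<delta> powr p)" using L by simp
    show "AE t in circle_measure. norm (indicator (- \<Gamma>) (cis t) * norm (fs t) powr p) \<le> norm (L t / \<delta> powr p)"
      using offL by eventually_elim (auto simp: indicator_def L0)
  qed measurable
  have rp: "r \<le> p"
  proof -
    have "1 / p \<le> 1 / r" using r s by simp
    then show ?thesis using p r(1) by (simp add: field_simps)
  qed
  show "integrable circle_measure (\<lambda>t. norm (fs t) powr r)"
  proof (rule Bochner_Integration.integrable_bound)
    show "integrable circle_measure (\<lambda>t. (1 + indicator (- \<Gamma>) (cis t) * norm (fs t) powr p)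
        + (L t + indicator \<Gamma> (cis t) * norm (F t) powr s))"
      using off_int L Fs by (intro Bochner_Integration.integrable_add) auto
    show "AE t in circle_measure. norm (norm (fs t) powr r)
        \<le> norm ((1 + indicator (- \<Gamma>) (cis t) * norm (fs t) powr p)
        + (L t + indicator \<Gamma> (cis t) * norm (F t) powr s))"
      using onL
    proof eventually_elim
      case (elim t)
      show ?case
      proof (cases "cis t \<in> \<Gamma>")
        case True then show ?thesis using elim L0[of t] by simp
      next
        case False
        have "norm (fs t) powr r \<le> 1 + norm (fs t) powr p"
        proof (cases "norm (fs t) \<le> 1")
          case True
          then have "norm (fs t) powr r \<le> 1 powr r" using r by (intro powr_mono2) auto
          then show ?thesis by (simp add: add_increasing2)
        next
          case False
          then have "norm (fs t) powr r \<le> norm (fs t) powr p" using rp by (intro powr_mono) auto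
          then show ?thesis by simp
        qed
        then show ?thesis using False L0[of t] by simp
      qed
    qed
  qed measurable
qed

section \<open>Gluing across an arc\<close>

lemma contour_integral_rectpath_sides:
  assumes c: "continuous_on (path_image (rectpath a b)) f" and ab: "Re a < Re b" "Im a < Im b"
  shows "contour_integral (rectpath a b) f
    = contour_integral (linepath a (Complex (Re b) (Im a))) f
      + \<i> * integral {Im a..Im b} (\<lambda>t. f (Complex (Re b) t))
      - contour_integral (linepath (Complex (Re a) (Im b)) b) f
      - \<i> * integral {Im a..Im b} (\<lambda>t. f (Complex (Re a) t))"
proof -
  let ?b = "Complex (Re b) (Im a)" and ?d = "Complex (Re a) (Im b)"
  have "path_image (rectpath a b)
      = closed_segment a ?b \<union> closed_segment ?b b \<union> closed_segment b ?d \<union> closed_segment ?d a"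
    by (simp add: rectpath_def Let_def path_image_join Un_assoc)
  then have cs: "continuous_on (closed_segment a ?b) f" "continuous_on (closed_segment ?b b) f"
      "continuous_on (closed_segment b ?d) f" "continuous_on (closed_segment ?d a) f"
    using c by (auto intro: continuous_on_subset)
  note i = cs[THEN contour_integrable_continuous_linepath]
  have "contour_integral (rectpath a b) f
      = contour_integral (linepath a ?b) f + (contour_integral (linepath ?b b) f
        + (contour_integral (linepath b ?d) f + contour_integral (linepath ?d a) f))"
    unfolding rectpath_def Let_def using i by simp
  moreover have "contour_integral (linepath ?b b) f = \<i> * integral {Im a..Im b} (\<lambda>t. f (Complex (Re b) t))"
    using ab by (intro contour_integral_linepath_same_Re) auto
  moreover have "contour_integral (linepath ?d a) f = - contour_integral (linepath a ?d) f"
    by (rule contour_integral_reverse_linepath[OF cs(4)])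
  moreover have "contour_integral (linepath a ?d) f = \<i> * integral {Im a..Im b} (\<lambda>t. f (Complex (Re a) t))"
    using ab by (intro contour_integral_linepath_same_Re) auto
  moreover have "contour_integral (linepath b ?d) f = - contour_integral (linepath ?d b) f"
    by (rule contour_integral_reverse_linepath[OF cs(3)])
  ultimately show ?thesis by simp
qed

text \<open>The edge left over is the one next to the interface, where no bound uniform in the
  distance is available: the left edge for a rectangle to the right of it, the right edge for one to
  the left. The factor of \<open>D\<close> is the total length of the other three sides.\<close>

lemma
  assumes c: "continuous_on (path_image (rectpath a b)) f" and ab: "Re a < Re b" "Im a < Im b" and D: "0 \<le> D"
    and I: "(f has_contour_integral I) (rectpath a b)"
    and hor: "\<And>w. w \<in> cbox a b \<Longrightarrow> Im w = Im a \<or> Im w = Im b \<Longrightarrow> norm (f w) \<le> D"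
  shows rectpath_integral_left_edge:
      "(\<And>w. w \<in> cbox a b \<Longrightarrow> Re w = Re b \<Longrightarrow> norm (f w) \<le> D) \<Longrightarrow>
        norm (I + \<i> * integral {Im a..Im b} (\<lambda>t. f (Complex (Re a) t)))
          \<le> D * (2 * (Re b - Re a) + (Im b - Im a))"
    and rectpath_integral_right_edge:
      "(\<And>w. w \<in> cbox a b \<Longrightarrow> Re w = Re a \<Longrightarrow> norm (f w) \<le> D) \<Longrightarrow>
        norm (I - \<i> * integral {Im a..Im b} (\<lambda>t. f (Complex (Re b) t)))
          \<le> D * (2 * (Re b - Re a) + (Im b - Im a))"
proof -
  have P: "path_image (rectpath a b) = {z. Re z \<in> {Re a, Re b} \<and> Im z \<in> {Im a..Im b}} \<union>
      {z. Im z \<in> {Im a, Im b} \<and> Re z \<in> {Re a..Re b}}"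
    using ab by (intro path_image_rectpath) auto
  have hb: "norm (contour_integral (linepath u v) f) \<le> D * (Re b - Re a)"
    if "Re u = Re a" "Re v = Re b" "Im u = Im v" "Im v \<in> {Im a, Im b}" for u v
  proof -
    have seg: "closed_segment u v = {z. Im z = Im u \<and> Re z \<in> {Re a..Re b}}"
      using that ab by (simp add: closed_segment_same_Im closed_segment_eq_real_ivl)
    then have "closed_segment u v \<subseteq> path_image (rectpath a b)" unfolding P using that by auto
    then have "(f has_contour_integral contour_integral (linepath u v) f) (linepath u v)"
      using c by (intro has_contour_integral_integral contour_integrable_continuous_linepath)
        (auto intro: continuous_on_subset)
    then have "norm (contour_integral (linepath u v) f) \<le> D * norm (v - u)"
    proof (rule has_contour_integral_bound_linepath[OF _ D])
      fix w assume w: "w \<in> closed_segment u v"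
      then show "norm (f w) \<le> D"
        using that ab unfolding seg by (intro hor) (auto simp: in_cbox_complex_iff)
    qed
    also have "v - u = of_real (Re b - Re a)" using that by (auto simp: complex_eq_iff)
    finally show ?thesis using ab by (simp only: norm_of_real abs_of_pos diff_gt_0_iff_gt)
  qed
  have vb: "norm (integral {Im a..Im b} (\<lambda>t. f (Complex x t))) \<le> D * (Im b - Im a)"
    if "x \<in> {Re a, Re b}" "\<And>w. w \<in> cbox a b \<Longrightarrow> Re w = x \<Longrightarrow> norm (f w) \<le> D" for x
  proof (rule integral_bound)
    show "continuous_on {Im a..Im b} (\<lambda>t. f (Complex x t))"
      by (intro continuous_on_compose2[OF c] continuous_intros) (use that in \<open>auto simp: P\<close>)
    show "norm (f (Complex x t)) \<le> D" if "t \<in> {Im a..Im b}" for t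
      using that \<open>x \<in> _\<close> ab by (intro \<open>\<And>w. w \<in> cbox a b \<Longrightarrow> Re w = x \<Longrightarrow> norm (f w) \<le> D\<close>) (auto simp: in_cbox_complex_iff)
  qed (use ab in auto)
  define bo ri to le where "bo = contour_integral (linepath a (Complex (Re b) (Im a))) f"
    and "ri = integral {Im a..Im b} (\<lambda>t. f (Complex (Re b) t))"
    and "to = contour_integral (linepath (Complex (Re a) (Im b)) b) f"
    and "le = integral {Im a..Im b} (\<lambda>t. f (Complex (Re a) t))"
  have Ieq: "I = bo + \<i> * ri - to - \<i> * le"
    using contour_integral_rectpath_sides[OF c ab] contour_integral_unique[OF I]
    by (simp add: bo_def ri_def to_def le_def)
  have bt: "norm bo \<le> D * (Re b - Re a)" "norm to \<le> D * (Re b - Re a)"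
    unfolding bo_def to_def by (rule hb; simp)+
  show "norm (I + \<i> * le) \<le> D * (2 * (Re b - Re a) + (Im b - Im a))"
    if "\<And>w. w \<in> cbox a b \<Longrightarrow> Re w = Re b \<Longrightarrow> norm (f w) \<le> D"
  proof -
    have "norm ri \<le> D * (Im b - Im a)" unfolding ri_def using ab that by (intro vb) auto
    moreover have "norm (I + \<i> * le) \<le> norm bo + norm (\<i> * ri) + norm to"
      unfolding Ieq using norm_triangle_ineq4[of "bo + \<i> * ri" to] norm_triangle_ineq[of bo "\<i> * ri"] by simp
    ultimately show ?thesis using bt by (simp add: norm_mult algebra_simps)
  qed
  show "norm (I - \<i> * ri) \<le> D * (2 * (Re b - Re a) + (Im b - Im a))"
    if "\<And>w. w \<in> cbox a b \<Longrightarrow> Re w = Re a \<Longrightarrow> norm (f w) \<le> D"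
  proof -
    have "norm le \<le> D * (Im b - Im a)" unfolding le_def using ab that by (intro vb) auto
    moreover have "norm (I - \<i> * ri) \<le> norm bo + norm to + norm (\<i> * le)"
      unfolding Ieq using norm_triangle_ineq4[of "bo - to" "\<i> * le"] norm_triangle_ineq4[of bo to]
      by (simp add: algebra_simps)
    ultimately show ?thesis using bt by (simp add: norm_mult algebra_simps)
  qed
qed

lemma powr_add_le:
  fixes a b r :: real
  assumes "0 \<le> a" "0 \<le> b" "0 \<le> r"
  shows "(a + b) powr r \<le> 2 powr r * (a powr r + b powr r)"
proof -
  have "(a + b) powr r \<le> (2 * max a b) powr r" using assms by (intro powr_mono2) auto
  also have "\<dots> = 2 powr r * max a b powr r" using assms by (simp add: powr_mult)
  also have "\<dots> \<le> 2 powr r * (a powr r + b powr r)" by (intro mult_left_mono) (auto simp: max_def)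
  finally show ?thesis .
qed

text \<open>Cauchy's formula on the two rectangles adjacent to the segment, where the edges next to the
  segment cancel in the limit. The factor \<open>Q\<close> vanishes at the two points where the outer contour
  meets the segment, and so compensates the growth of \<open>G1\<close> and \<open>G2\<close> there.\<close>

lemma glued_function_bounded:
  fixes G1 G2 :: "complex \<Rightarrow> complex" and \<epsilon> :: "nat \<Rightarrow> real"
  assumes \<eta>: "0 < \<eta>" "\<eta> \<le> 1" and C: "0 \<le> C" and r: "1 < r"
    and h1: "G1 holomorphic_on {w. -2*\<eta> < Re w \<and> Re w < 0 \<and> \<bar>Im w - y\<bar> < 2*\<eta>}"
    and h2: "G2 holomorphic_on {w. 0 < Re w \<and> Re w < 2*\<eta> \<and> \<bar>Im w - y\<bar> < 2*\<eta>}"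
    and g1: "\<And>w. -2*\<eta> < Re w \<Longrightarrow> Re w < 0 \<Longrightarrow> \<bar>Im w - y\<bar> < 2*\<eta> \<Longrightarrow> norm (G1 w) \<le> C / \<bar>Re w\<bar>"
    and g2: "\<And>w. 0 < Re w \<Longrightarrow> Re w < 2*\<eta> \<Longrightarrow> \<bar>Im w - y\<bar> < 2*\<eta> \<Longrightarrow> norm (G2 w) \<le> C / \<bar>Re w\<bar>"
    and \<epsilon>: "\<And>j. 0 < \<epsilon> j" "\<epsilon> \<longlonglongrightarrow> 0"
    and lim: "AE t in lebesgue_on {y-\<eta>..y+\<eta>}. \<exists>l. (\<lambda>j. G1 (Complex (- \<epsilon> j) t)) \<longlonglongrightarrow> l \<and>
        (\<lambda>j. G2 (Complex (\<epsilon> j) t)) \<longlonglongrightarrow> l"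
    and b1: "\<And>j. \<epsilon> j < \<eta> \<Longrightarrow> (LINT t|lebesgue_on {y-\<eta>..y+\<eta>}. norm (G1 (Complex (- \<epsilon> j) t)) powr r) \<le> B"
    and b2: "\<And>j. \<epsilon> j < \<eta> \<Longrightarrow> (LINT t|lebesgue_on {y-\<eta>..y+\<eta>}. norm (G2 (Complex (\<epsilon> j) t)) powr r) \<le> B"
    and w0: "-\<eta>/2 < Re w0" "Re w0 < 0" "\<bar>Im w0 - y\<bar> < \<eta>/2"
  shows "norm (G1 w0) \<le> 288 * C / (pi * \<eta>\<^sup>2)"
proof -
  let ?S1 = "{w. -2*\<eta> < Re w \<and> Re w < 0 \<and> \<bar>Im w - y\<bar> < 2*\<eta>}"
  let ?S2 = "{w. 0 < Re w \<and> Re w < 2*\<eta> \<and> \<bar>Im w - y\<bar> < 2*\<eta>}"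
  define \<alpha> \<beta> where "\<alpha> = y - \<eta>" and "\<beta> = y + \<eta>"
  define Q where "Q w = (w - Complex 0 \<alpha>) * (w - Complex 0 \<beta>)" for w
  define K where "K w = Q w / (w - w0)" for w
  let ?M = "lebesgue_on {\<alpha>..\<beta>}"
  interpret M: finite_measure ?M by (rule finite_measure_lebesgue_on) simp
  have w0I: "y - \<eta>/2 < Im w0" "Im w0 < y + \<eta>/2" using w0(3) by linarith+
  have S1eq: "?S1 = box (Complex (-2*\<eta>) (y-2*\<eta>)) (Complex 0 (y+2*\<eta>))"
    by (auto simp: in_box_complex_iff abs_less_iff)
  have S2eq: "?S2 = box (Complex 0 (y-2*\<eta>)) (Complex (2*\<eta>) (y+2*\<eta>))"
    by (auto simp: in_box_complex_iff abs_less_iff)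
  have Qh: "Q holomorphic_on A" for A unfolding Q_def by (intro holomorphic_intros)
  \<comment> \<open>On a horizontal side one zero of \<open>Q\<close> is at distance
    \<open>|Re w|\<close>, and on an outer vertical side both are within
    \<open>3 * \<eta> = 3 * |Re w|\<close>; the other factor is at most 3. Thus \<open>Q\<close>
    cancels the growth \<open>C / |Re w|\<close>. The point \<open>w0\<close> lies in the inner
    half, hence at distance at least \<open>\<eta> / 2\<close> from these sides, and together this
    gives \<open>18 * C / \<eta>\<close>.\<close>
  have Qb: "norm (Q w) \<le> 9 * \<bar>Re w\<bar>" and Nb: "\<eta> / 2 \<le> norm (w - w0)"
    if "\<bar>Re w\<bar> \<le> \<eta>" "\<bar>Im w - y\<bar> \<le> \<eta>" "Im w = \<alpha> \<or> Im w = \<beta> \<or> \<bar>Re w\<bar> = \<eta>" for w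
  proof -
    have n: "norm (w - Complex 0 \<alpha>) \<le> \<bar>Re w\<bar> + \<bar>Im w - \<alpha>\<bar>" "norm (w - Complex 0 \<beta>) \<le> \<bar>Re w\<bar> + \<bar>Im w - \<beta>\<bar>"
      using cmod_le[of "w - Complex 0 \<alpha>"] cmod_le[of "w - Complex 0 \<beta>"] by auto
    have le3: "norm (w - Complex 0 \<alpha>) \<le> 3" "norm (w - Complex 0 \<beta>) \<le> 3"
      using n that \<eta> unfolding \<alpha>_def \<beta>_def by linarith+
    have "norm (w - Complex 0 \<alpha>) \<le> 3 * \<bar>Re w\<bar> \<or> norm (w - Complex 0 \<beta>) \<le> 3 * \<bar>Re w\<bar>"
      using n that \<eta> unfolding \<alpha>_def \<beta>_def by linarith
    then show "norm (Q w) \<le> 9 * \<bar>Re w\<bar>"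
      using mult_mono[OF _ le3(2), of "norm (w - Complex 0 \<alpha>)" "3 * \<bar>Re w\<bar>"]
        mult_mono[OF le3(1), of "norm (w - Complex 0 \<beta>)" "3 * \<bar>Re w\<bar>"]
      by (auto simp: Q_def norm_mult)
    show "\<eta> / 2 \<le> norm (w - w0)"
      using abs_Re_le_cmod[of "w - w0"] abs_Im_le_cmod[of "w - w0"] that w0
      unfolding \<alpha>_def \<beta>_def minus_complex.sel by linarith
  qed
  let ?D = "18 * C / \<eta>"
  have side: "norm (Q w * G w / (w - w0)) \<le> ?D"
    if "\<bar>Re w\<bar> \<le> \<eta>" "\<bar>Im w - y\<bar> \<le> \<eta>" "Im w = \<alpha> \<or> Im w = \<beta> \<or> \<bar>Re w\<bar> = \<eta>" "Re w \<noteq> 0"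
      "norm (G w) \<le> C / \<bar>Re w\<bar>" for w and G :: "complex \<Rightarrow> complex"
  proof -
    have "norm (Q w) * norm (G w) \<le> (9 * \<bar>Re w\<bar>) * (C / \<bar>Re w\<bar>)"
      using Qb[OF that(1-3)] that by (intro mult_mono) auto
    also have "\<dots> = 9 * C" using that by simp
    finally have "norm (Q w) * norm (G w) / norm (w - w0) \<le> 9 * C / (\<eta> / 2)"
      using Nb[OF that(1-3)] \<eta> C by (intro frac_le) auto
    then show ?thesis by (simp add: norm_mult norm_divide)
  qed
  \<comment> \<open>Dropping finitely many terms keeps both inner edges at distance at least
    \<open>|Re w0| / 2\<close> from \<open>w0\<close> and puts \<open>w0\<close> inside the left
    rectangle.\<close>
  have eb: "\<forall>\<^sub>F j in sequentially. \<epsilon> j < \<bar>Re w0\<bar> / 2"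
    using \<epsilon>(2) w0 by (intro order_tendstoD(2)[of _ 0]) auto
  then obtain N where N: "\<And>j. j \<ge> N \<Longrightarrow> \<epsilon> j < \<bar>Re w0\<bar> / 2" by (auto simp: eventually_sequentially)
  define e where "e j = \<epsilon> (j + N)" for j
  have e: "0 < e j" "e j < \<bar>Re w0\<bar> / 2" "e j < \<eta>" for j
    using \<epsilon>(1)[of "j + N"] N[of "j + N"] w0 by (auto simp: e_def)
  have e0: "e \<longlonglongrightarrow> 0" unfolding e_def using LIMSEQ_ignore_initial_segment[OF \<epsilon>(2)] .
  define E1 E2 where "E1 j t = K (Complex (- e j) t) * G1 (Complex (- e j) t)"
    and "E2 j t = K (Complex (e j) t) * G2 (Complex (e j) t)" for j t
  have m1: "Complex (- e j) t \<in> ?S1" and m2: "Complex (e j) t \<in> ?S2" if "t \<in> {\<alpha>..\<beta>}" for j t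
    using that e[of j] \<eta> by (auto simp: \<alpha>_def \<beta>_def abs_less_iff)
  have ne: "Complex x t \<noteq> w0" if "\<bar>x\<bar> < \<bar>Re w0\<bar>" for x t using that by auto
  have Kc: "continuous_on {\<alpha>..\<beta>} (\<lambda>t. K (Complex x t))" if "\<bar>x\<bar> < \<bar>Re w0\<bar>" for x
    unfolding K_def Q_def using ne[OF that] by (intro continuous_intros) auto
  have G1c: "continuous_on {\<alpha>..\<beta>} (\<lambda>t. G1 (Complex (- e j) t))" for j
    by (intro continuous_on_compose2[OF holomorphic_on_imp_continuous_on[OF h1]] continuous_intros) (use m1 in auto)
  have G2c: "continuous_on {\<alpha>..\<beta>} (\<lambda>t. G2 (Complex (e j) t))" for j
    by (intro continuous_on_compose2[OF holomorphic_on_imp_continuous_on[OF h2]] continuous_intros) (use m2 in auto)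
  have Ec: "continuous_on {\<alpha>..\<beta>} (E1 j)" "continuous_on {\<alpha>..\<beta>} (E2 j)" for j
    unfolding E1_def E2_def using e[of j] by (intro continuous_intros Kc G1c G2c; simp)+
  \<comment> \<open>Cauchy's formula on the left rectangle, which contains \<open>w0\<close>, plus
    Cauchy's theorem on the right one. The three outer sides of each have length at most
    \<open>4 * \<eta>\<close> and contribute at most \<open>72 * C\<close>; the two inner edges run
    in opposite directions and leave the difference of \<open>E1\<close> and
    \<open>E2\<close>.\<close>
  have main: "2 * pi * norm (Q w0) * norm (G1 w0) \<le> 144 * C + (LINT t|?M. norm (E1 j t - E2 j t))" for j
  proof -
    let ?a = "Complex (- \<eta>) \<alpha>" and ?b = "Complex (- e j) \<beta>"
    let ?c = "Complex (e j) \<alpha>" and ?d = "Complex \<eta> \<beta>"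
    have ab: "\<alpha> < \<beta>" using \<eta> by (simp add: \<alpha>_def \<beta>_def)
    have sub1: "cbox ?a ?b \<subseteq> ?S1" and sub2: "cbox ?c ?d \<subseteq> ?S2"
      using e[of j] \<eta> by (auto simp: in_cbox_complex_iff \<alpha>_def \<beta>_def abs_less_iff)
    have w0b: "w0 \<in> box ?a ?b" using w0(1,2) w0I \<eta> e[of j] by (auto simp: in_box_complex_iff \<alpha>_def \<beta>_def)
    have w0S: "w0 \<in> ?S1" using w0 \<eta> by auto
    have pi1: "path_image (rectpath ?a ?b) \<subseteq> cbox ?a ?b - {w0}"
      using w0b path_image_rectpath_cbox_minus_box[of ?a ?b] e[of j] ab by auto
    have pi2: "path_image (rectpath ?c ?d) \<subseteq> cbox ?c ?d"
      using e[of j] ab by (intro path_image_rectpath_subset_cbox) auto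
    have I1: "((\<lambda>w. Q w * G1 w / (w - w0)) has_contour_integral
        (2 * pi * \<i> * winding_number (rectpath ?a ?b) w0 * (Q w0 * G1 w0))) (rectpath ?a ?b)"
    proof (rule Cauchy_integral_formula_convex_simple[of ?S1])
      show "convex ?S1" unfolding S1eq by (rule convex_box)
      show "w0 \<in> interior ?S1" using w0S unfolding S1eq by (simp add: interior_open open_box)
      show "(\<lambda>w. Q w * G1 w) holomorphic_on ?S1" by (intro holomorphic_intros Qh h1)
    qed (use pi1 sub1 in auto)
    have I2: "((\<lambda>w. Q w * G2 w / (w - w0)) has_contour_integral 0) (rectpath ?c ?d)"
    proof (rule Cauchy_theorem_convex_simple[of _ ?S2])
      show "convex ?S2" unfolding S2eq by (rule convex_box)
      show "(\<lambda>w. Q w * G2 w / (w - w0)) holomorphic_on ?S2"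
        using w0 by (intro holomorphic_intros Qh h2) auto
    qed (use pi2 sub2 in auto)
    have edge1: "norm (2 * pi * \<i> * winding_number (rectpath ?a ?b) w0 * (Q w0 * G1 w0)
        - \<i> * integral {Im ?a..Im ?b} (\<lambda>t. Q (Complex (Re ?b) t) * G1 (Complex (Re ?b) t) / (Complex (Re ?b) t - w0)))
       \<le> ?D * (2 * (Re ?b - Re ?a) + (Im ?b - Im ?a))"
    proof (rule rectpath_integral_right_edge[OF _ _ _ _ I1])
      show "continuous_on (path_image (rectpath ?a ?b)) (\<lambda>w. Q w * G1 w / (w - w0))"
        using pi1 sub1
        by (intro holomorphic_on_imp_continuous_on holomorphic_intros Qh holomorphic_on_subset[OF h1]) auto
    next
      fix w assume w: "w \<in> cbox ?a ?b" "Im w = Im ?a \<or> Im w = Im ?b"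
      then show "norm (Q w * G1 w / (w - w0)) \<le> ?D"
        using e[of j] \<eta> sub1 by (intro side g1) (auto simp: in_cbox_complex_iff \<alpha>_def \<beta>_def)
    next
      fix w assume w: "w \<in> cbox ?a ?b" "Re w = Re ?a"
      then show "norm (Q w * G1 w / (w - w0)) \<le> ?D"
        using e[of j] \<eta> sub1 by (intro side g1) (auto simp: in_cbox_complex_iff \<alpha>_def \<beta>_def)
    qed (use e[of j] ab C \<eta> in auto)
    have edge2: "norm (0 + \<i> * integral {Im ?c..Im ?d} (\<lambda>t. Q (Complex (Re ?c) t) * G2 (Complex (Re ?c) t) / (Complex (Re ?c) t - w0)))
       \<le> ?D * (2 * (Re ?d - Re ?c) + (Im ?d - Im ?c))"
    proof (rule rectpath_integral_left_edge[OF _ _ _ _ I2])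
      show "continuous_on (path_image (rectpath ?c ?d)) (\<lambda>w. Q w * G2 w / (w - w0))"
        using pi2 sub2 w0
        by (intro holomorphic_on_imp_continuous_on holomorphic_intros Qh holomorphic_on_subset[OF h2]) auto
    next
      fix w assume w: "w \<in> cbox ?c ?d" "Im w = Im ?c \<or> Im w = Im ?d"
      then show "norm (Q w * G2 w / (w - w0)) \<le> ?D"
        using e[of j] \<eta> sub2 by (intro side g2) (auto simp: in_cbox_complex_iff \<alpha>_def \<beta>_def)
    next
      fix w assume w: "w \<in> cbox ?c ?d" "Re w = Re ?d"
      then show "norm (Q w * G2 w / (w - w0)) \<le> ?D"
        using e[of j] \<eta> sub2 by (intro side g2) (auto simp: in_cbox_complex_iff \<alpha>_def \<beta>_def)
    qed (use e[of j] ab C \<eta> in auto)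
    define W where "W = 2 * pi * \<i> * (Q w0 * G1 w0)"
    have n1: "norm (W - \<i> * integral {\<alpha>..\<beta>} (E1 j)) \<le> ?D * (2 * (\<eta> - e j) + (\<beta> - \<alpha>))"
      using edge1 winding_number_rectpath[OF w0b] by (simp add: W_def E1_def[abs_def] K_def)
    have n2: "norm (\<i> * integral {\<alpha>..\<beta>} (E2 j)) \<le> ?D * (2 * (\<eta> - e j) + (\<beta> - \<alpha>))"
      using edge2 by (simp add: E2_def[abs_def] K_def)
    have Dle: "?D * (2 * (\<eta> - e j) + (\<beta> - \<alpha>)) \<le> 72 * C"
    proof -
      have "?D * (2 * (\<eta> - e j) + (\<beta> - \<alpha>)) \<le> ?D * (4 * \<eta>)"
        using e[of j] C \<eta> by (intro mult_left_mono) (auto simp: \<alpha>_def \<beta>_def)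
      also have "\<dots> = 72 * C" using \<eta> by simp
      finally show ?thesis .
    qed
    have "norm (integral {\<alpha>..\<beta>} (E1 j) - integral {\<alpha>..\<beta>} (E2 j)) \<le> (LINT t|?M. norm (E1 j t - E2 j t))"
    proof -
      have i: "integrable ?M (E1 j)" "integrable ?M (E2 j)" using Ec by (auto intro: continuous_imp_integrable_real)
      have "integral {\<alpha>..\<beta>} (E1 j) - integral {\<alpha>..\<beta>} (E2 j) = (LINT t|?M. E1 j t - E2 j t)"
        using i by (simp add: lebesgue_integral_eq_integral)
      then show ?thesis by (simp add: integral_norm_bound)
    qed
    moreover have "W = (W - \<i> * integral {\<alpha>..\<beta>} (E1 j)) + \<i> * integral {\<alpha>..\<beta>} (E2 j)
        + \<i> * (integral {\<alpha>..\<beta>} (E1 j) - integral {\<alpha>..\<beta>} (E2 j))"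
      by (simp add: algebra_simps)
    then have "norm W \<le> norm (W - \<i> * integral {\<alpha>..\<beta>} (E1 j)) + norm (\<i> * integral {\<alpha>..\<beta>} (E2 j))
        + norm (\<i> * (integral {\<alpha>..\<beta>} (E1 j) - integral {\<alpha>..\<beta>} (E2 j)))"
      by (metis norm_triangle_ineq norm_triangle_mono order_refl)
    moreover have "norm W = 2 * pi * norm (Q w0) * norm (G1 w0)" by (simp add: W_def norm_mult)
    ultimately show ?thesis using n1 n2 Dle by (simp add: norm_mult)
  qed
  have "(\<lambda>j. LINT t|?M. norm (E1 j t - E2 j t)) \<longlonglongrightarrow> 0"
  proof (rule M.integral_tendsto_0_of_Lp_bounded[OF r])
    have "continuous_on {\<alpha>..\<beta>} (\<lambda>t. norm (E1 j t - E2 j t))" for j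
      by (intro continuous_intros Ec)
    then show "(\<lambda>t. norm (E1 j t - E2 j t)) \<in> borel_measurable ?M" for j
      by (intro borel_measurable_integrable continuous_imp_integrable_real)
    have ip: "integrable ?M (\<lambda>t. norm (h t) powr r)"
      if "continuous_on {\<alpha>..\<beta>} h" for h :: "real \<Rightarrow> complex"
      using r that by (intro continuous_imp_integrable_real continuous_on_powr' continuous_intros) auto
    show "integrable ?M (\<lambda>t. norm (E1 j t - E2 j t) powr r)" for j
      by (intro ip continuous_intros Ec)
    show "AE t in ?M. (\<lambda>j. norm (E1 j t - E2 j t)) \<longlonglongrightarrow> 0"
      using lim unfolding \<alpha>_def[symmetric] \<beta>_def[symmetric]
    proof eventually_elim
      case (elim t)
      then obtain l where l: "(\<lambda>j. G1 (Complex (- \<epsilon> j) t)) \<longlonglongrightarrow> l" "(\<lambda>j. G2 (Complex (\<epsilon> j) t)) \<longlonglongrightarrow> l" by blast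
      have l': "(\<lambda>j. G1 (Complex (- e j) t)) \<longlonglongrightarrow> l" "(\<lambda>j. G2 (Complex (e j) t)) \<longlonglongrightarrow> l"
        unfolding e_def using LIMSEQ_ignore_initial_segment[OF l(1)] LIMSEQ_ignore_initial_segment[OF l(2)] by auto
      have cx: "(\<lambda>j. Complex (- e j) t) \<longlonglongrightarrow> Complex (- 0) t" "(\<lambda>j. Complex (e j) t) \<longlonglongrightarrow> Complex 0 t"
        by (intro tendsto_intros e0)+
      have n0: "Complex 0 t \<noteq> w0" using w0 by auto
      have Kt: "(\<lambda>j. K (Complex (- e j) t)) \<longlonglongrightarrow> K (Complex 0 t)" "(\<lambda>j. K (Complex (e j) t)) \<longlonglongrightarrow> K (Complex 0 t)"
        unfolding K_def Q_def using n0 cx by (auto intro!: tendsto_intros)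
      have "(\<lambda>j. norm (E1 j t - E2 j t)) \<longlonglongrightarrow> norm (K (Complex 0 t) * l - K (Complex 0 t) * l)"
        unfolding E1_def E2_def by (intro tendsto_intros Kt l')
      then show ?case by simp
    qed
    \<comment> \<open>\<open>Q\<close> is at most 9 on the inner edges, and these stay
      \<open>|Re w0| / 2\<close> away from \<open>w0\<close>. This bound degenerates as
      \<open>w0\<close> approaches the axis, but it serves only to obtain convergence in mean and
      does not enter the final estimate.\<close>
    define c where "c = 18 / \<bar>Re w0\<bar>"
    have Kb: "norm (K (Complex x t)) \<le> c" if "\<bar>x\<bar> < \<bar>Re w0\<bar> / 2" "t \<in> {\<alpha>..\<beta>}" for x t
    proof -
      have "norm (Complex x t - Complex 0 \<alpha>) \<le> 3" "norm (Complex x t - Complex 0 \<beta>) \<le> 3"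
        using cmod_le[of "Complex x t - Complex 0 \<alpha>"] cmod_le[of "Complex x t - Complex 0 \<beta>"] that w0 \<eta>
        unfolding \<alpha>_def \<beta>_def by auto
      then have "norm (Q (Complex x t)) \<le> 3 * 3" unfolding Q_def norm_mult by (intro mult_mono) auto
      moreover have "\<bar>Re w0\<bar> / 2 \<le> norm (Complex x t - w0)"
        using abs_Re_le_cmod[of "Complex x t - w0"] that w0 by simp
      ultimately have "norm (Q (Complex x t)) / norm (Complex x t - w0) \<le> 9 / (\<bar>Re w0\<bar> / 2)"
        using w0 by (intro frac_le) auto
      then show ?thesis by (simp add: K_def c_def norm_divide)
    qed
    have c0: "0 \<le> c" by (simp add: c_def)
    show "(LINT t|?M. norm (E1 j t - E2 j t) powr r) \<le> c powr r * 2 powr r * (B + B)" for j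
    proof -
      have "(LINT t|?M. norm (E1 j t - E2 j t) powr r)
          \<le> (LINT t|?M. c powr r * 2 powr r *
            (norm (G1 (Complex (- e j) t)) powr r + norm (G2 (Complex (e j) t)) powr r))"
      proof (rule integral_mono)
        show "integrable ?M (\<lambda>t. norm (E1 j t - E2 j t) powr r)" by (intro ip continuous_intros Ec)
        show "integrable ?M (\<lambda>t. c powr r * 2 powr r *
            (norm (G1 (Complex (- e j) t)) powr r + norm (G2 (Complex (e j) t)) powr r))"
          by (intro integrable_mult_right Bochner_Integration.integrable_add ip G1c G2c)
        fix t assume "t \<in> space ?M"
        then have t: "t \<in> {\<alpha>..\<beta>}" by simp
        have "norm (E1 j t - E2 j t) \<le> norm (E1 j t) + norm (E2 j t)" by (rule norm_triangle_ineq4)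
        also have "\<dots> \<le> c * norm (G1 (Complex (- e j) t)) + c * norm (G2 (Complex (e j) t))"
          unfolding E1_def E2_def norm_mult using Kb[OF _ t] e[of j]
          by (intro add_mono mult_right_mono) auto
        also have "\<dots> = c * (norm (G1 (Complex (- e j) t)) + norm (G2 (Complex (e j) t)))"
          by (simp add: distrib_left)
        finally have "norm (E1 j t - E2 j t) powr r
            \<le> (c * (norm (G1 (Complex (- e j) t)) + norm (G2 (Complex (e j) t)))) powr r"
          using r by (intro powr_mono2) auto
        also have "\<dots> = c powr r * (norm (G1 (Complex (- e j) t)) + norm (G2 (Complex (e j) t))) powr r"
          using c0 by (simp add: powr_mult)
        also have "\<dots> \<le> c powr r * (2 powr r * (norm (G1 (Complex (- e j) t)) powr r + norm (G2 (Complex (e j) t)) powr r))"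
          using r by (intro mult_left_mono powr_add_le) auto
        finally show "norm (E1 j t - E2 j t) powr r \<le> c powr r * 2 powr r *
            (norm (G1 (Complex (- e j) t)) powr r + norm (G2 (Complex (e j) t)) powr r)"
          by (simp add: mult.assoc)
      qed
      also have "\<dots> = c powr r * 2 powr r * ((LINT t|?M. norm (G1 (Complex (- e j) t)) powr r)
          + (LINT t|?M. norm (G2 (Complex (e j) t)) powr r))"
        using ip[OF G1c] ip[OF G2c] by simp
      also have "\<dots> \<le> c powr r * 2 powr r * (B + B)"
        using b1[of "j + N"] b2[of "j + N"] e[of j] unfolding \<alpha>_def \<beta>_def e_def
        by (intro mult_left_mono add_mono) auto
      finally show ?thesis .
    qed
  qed auto
  then have "(\<lambda>j. 144 * C + (LINT t|?M. norm (E1 j t - E2 j t))) \<longlonglongrightarrow> 144 * C + 0"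
    by (intro tendsto_intros)
  then have le: "2 * pi * norm (Q w0) * norm (G1 w0) \<le> 144 * C"
    using LIMSEQ_le_const[of _ "144 * C"] main by fastforce
  \<comment> \<open>Both zeros of \<open>Q\<close> differ from \<open>w0\<close> by at least
    \<open>\<eta> / 2\<close> in the imaginary part, uniformly in \<open>Re w0\<close>. Dividing
    \<open>144 * C\<close> by \<open>2 * pi * \<eta>^2 / 4\<close> gives the constant of the
    lemma.\<close>
  have "(\<eta> / 2) * (\<eta> / 2) \<le> norm (Q w0)"
    unfolding Q_def norm_mult
    using abs_Im_le_cmod[of "w0 - Complex 0 \<alpha>"] abs_Im_le_cmod[of "w0 - Complex 0 \<beta>"] w0I \<eta>
    by (intro mult_mono) (auto simp: \<alpha>_def \<beta>_def)
  then have "2 * pi * ((\<eta> / 2) * (\<eta> / 2)) * norm (G1 w0) \<le> 2 * pi * norm (Q w0) * norm (G1 w0)"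
    by (intro mult_right_mono mult_left_mono) auto
  from this le have "2 * pi * ((\<eta> / 2) * (\<eta> / 2)) * norm (G1 w0) \<le> 144 * C" by (rule order_trans)
  moreover have "2 * pi * ((\<eta> / 2) * (\<eta> / 2)) * norm (G1 w0) = norm (G1 w0) * (pi * \<eta>\<^sup>2) / 2"
    by (simp add: power2_eq_square)
  ultimately have "norm (G1 w0) * (pi * \<eta>\<^sup>2) \<le> 288 * C" by linarith
  then show ?thesis using \<eta> by (subst pos_le_divide_eq) auto
qed

section \<open>Boundedness near the arc\<close>

lemma rcis_periodic [simp]: "rcis r (t + 2 * pi) = rcis r t"
  by (simp add: rcis_def cis_mult[symmetric])

lemma has_boundary_value_periodic [simp]:
  "has_boundary_value f (t + 2 * pi) w \<longleftrightarrow> has_boundary_value f t w"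
  by (simp add: has_boundary_value_def)

text \<open>A window around an angle close to 0 or \<open>2 * pi\<close> leaves the parameter
  interval. Within three periods the exceptional set is covered by three translates of a null
  set.\<close>

lemma AE_periodic_interval:
  assumes AE: "AE t in circle_measure. P t" and per: "\<And>t. P (t + 2 * pi) = P t"
    and ab: "- 2 * pi \<le> a" "b \<le> 4 * pi"
  shows "AE t in lebesgue_on {a..b}. P t"
proof -
  define N where "N = {t \<in> {0..2*pi}. \<not> P t}"
  have "AE t in lebesgue. t \<in> {0..2*pi} \<longrightarrow> P t"
    using AE by (subst (asm) AE_restrict_space_iff) auto
  then obtain N' where N': "negligible N'" "{t. \<not> (t \<in> {0..2*pi} \<longrightarrow> P t)} \<subseteq> N'"
    unfolding eventually_ae_filter_negligible by blast
  then have N: "negligible N"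
    by (intro negligible_subset[OF N'(1)]) (auto simp: N_def)
  have "negligible (N \<union> ((+) (2*pi) ` N \<union> (+) (- 2*pi) ` N))"
    by (intro negligible_Un negligible_translation N)
  moreover have "{t. \<not> (t \<in> {a..b} \<longrightarrow> P t)} \<subseteq> N \<union> ((+) (2*pi) ` N \<union> (+) (- 2*pi) ` N)"
  proof
    fix t assume "t \<in> {t. \<not> (t \<in> {a..b} \<longrightarrow> P t)}"
    then have t: "-2*pi \<le> t" "t \<le> 4*pi" "\<not> P t" using ab by auto
    consider "t < 0" | "0 \<le> t" "t \<le> 2*pi" | "2*pi < t" by linarith
    then show "t \<in> N \<union> ((+) (2*pi) ` N \<union> (+) (- 2*pi) ` N)"
    proof cases
      case 1
      then have "t + 2*pi \<in> N" using t per[of t] by (simp add: N_def)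
      then show ?thesis by (intro UnI2) (auto intro!: image_eqI[of _ _ "t + 2*pi"])
    next
      case 2 then show ?thesis using t by (simp add: N_def)
    next
      case 3
      then have "t - 2*pi \<in> N" using t per[of "t - 2*pi"] by (simp add: N_def)
      then show ?thesis by (intro UnI2 UnI1) (auto intro!: image_eqI[of _ _ "t - 2*pi"])
    qed
  qed
  ultimately have "AE t in lebesgue. t \<in> {a..b} \<longrightarrow> P t"
    unfolding eventually_ae_filter_negligible by blast
  then show ?thesis by (subst AE_restrict_space_iff) auto
qed

text \<open>The factor 3 counts the periods in \<open>{- 2 * pi..4 * pi}\<close>.\<close>

lemma periodic_integral_le:
  fixes h :: "real \<Rightarrow> real"
  assumes c: "continuous_on UNIV h" and per: "\<And>t. h (t + 2 * pi) = h t" and nn: "\<And>t. 0 \<le> h t"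
    and ab: "- 2 * pi \<le> a" "b \<le> 4 * pi"
  shows "(LINT t|lebesgue_on {a..b}. h t) \<le> 3 * (LINT t|circle_measure. h t)"
proof -
  have ci: "continuous_on {u..v} h" for u v by (rule continuous_on_subset[OF c]) simp
  have io: "h integrable_on {u..v}" for u v by (intro integrable_continuous_real ci)
  have le: "(LINT t|lebesgue_on {u..v}. h t) = integral {u..v} h" for u v
    by (intro lebesgue_integral_eq_integral continuous_imp_integrable_real ci) auto
  have "integral {a..b} h \<le> integral {-2*pi..4*pi} h"
    using ab nn by (intro integral_subset_le io) auto
  also have "\<dots> = integral {-2*pi..0} h + integral {0..4*pi} h"
    by (intro Henstock_Kurzweil_Integration.integral_combine[symmetric] io) auto
  also have "integral {0..4*pi} h = integral {0..2*pi} h + integral {2*pi..4*pi} h"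
    by (intro Henstock_Kurzweil_Integration.integral_combine[symmetric] io) auto
  also have "integral {-2*pi..0} h = integral {0..2*pi} h"
    using integral_shift_real_ivl[of 0 "2*pi" "2*pi" h] per by simp
  also have "integral {2*pi..4*pi} h = integral {0..2*pi} h"
    using integral_shift_real_ivl[of "2*pi" "2*pi" "4*pi" h] per by simp
  finally show ?thesis unfolding le by simp
qed

section \<open>Exponential coordinates at a point of the circle\<close>

lemma exp_Complex: "exp (Complex x t) = rcis (exp x) t"
  by (simp add: exp_eq_polar rcis_def)

text \<open>From \<open>exp x \<le> 1 / (1 - x) \<le> 1 + x / 2\<close>. With
  \<open>z = exp w\<close> it converts growth \<open>C / (1 - norm z)\<close> into
  \<open>2 * C / |Re w|\<close>.\<close>

lemma one_minus_exp_ge: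
  fixes x :: real
  assumes "-1 \<le> x" "x < 0"
  shows "\<bar>x\<bar> / 2 \<le> 1 - exp x"
proof -
  have "exp x * (1 - x) \<le> exp x * exp (- x)" using exp_ge_add_one_self[of "- x"] by (intro mult_left_mono) auto
  also have "\<dots> = 1" by (simp add: exp_add[symmetric])
  finally have "exp x \<le> 1 / (1 - x)" using assms by (simp add: field_simps)
  moreover have "1 / (1 - x) \<le> 1 + x / 2"
    using assms mult_nonneg_nonneg[of "1 + x" "- x"] by (simp add: divide_simps) (simp add: algebra_simps)
  ultimately show ?thesis using assms by simp
qed

text \<open>The lower limit is nonnegative and not 0, so some positive \<open>c\<close> lies below
  it. As \<open>l\<close> is on the circle, the punctured filter omits no point of the disk.\<close>

lemma bounded_below_off_spectrum:
  assumes "norm l = 1" "l \<notin> spectrum I"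
  obtains c d where "0 < c" "0 < d" "\<And>z. norm z < 1 \<Longrightarrow> dist z l < d \<Longrightarrow> c < norm (I z)"
proof -
  let ?L = "Liminf (at l within ball 0 1) (\<lambda>z. ereal (norm (I z)))"
  have "?L \<noteq> 0" using assms by (auto simp: spectrum_def closure_ball)
  moreover have "0 \<le> ?L" by (rule Liminf_bounded) auto
  ultimately have "0 < ?L" by simp
  then obtain c where c: "0 < ereal c" "ereal c < ?L" using ereal_dense2 by blast
  then have "eventually (\<lambda>z. ereal c < ereal (norm (I z))) (at l within ball 0 1)"
    using le_Liminf_iff[of ?L "at l within ball 0 1" "\<lambda>z. ereal (norm (I z))"] by blast
  then obtain d where "0 < d" "\<And>z. z \<in> ball 0 1 \<Longrightarrow> z \<noteq> l \<Longrightarrow> dist z l < d \<Longrightarrow> c < norm (I z)"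
    by (auto simp: eventually_at)
  with that[of c d] c assms show thesis by fastforce
qed

text \<open>\<open>G1\<close> is \<open>f\<close> in the coordinate \<open>w\<close>, to the left of
  the imaginary axis, and \<open>G2\<close> is the reflection of \<open>\<psi> / I\<close>, to the
  right. Their limits on the axis agree: \<open>cnj (w / v) = v * cnj w = u\<close> because
  \<open>norm v = 1\<close>. So \<open>glued_function_bounded\<close> applies and bounds
  \<open>f\<close> up to the circle.\<close>

lemma boundary_bounded_off_spectrum:
  assumes r: "1 < r" and f: "f \<in> hardy_space r" and \<psi>: "\<psi> \<in> hardy_space r"
    and I: "I holomorphic_on ball 0 1"
    and C: "0 \<le> C" "\<And>z. norm z < 1 \<Longrightarrow> norm (f z) \<le> C / (1 - norm z)"
      "\<And>z. norm z < 1 \<Longrightarrow> norm (\<psi> z) \<le> C / (1 - norm z)"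
    and bv: "AE t in circle_measure. \<exists>u v w. has_boundary_value f t u \<and> has_boundary_value I t v \<and>
         has_boundary_value \<psi> t w \<and> u = v * cnj w \<and> norm v = 1"
    and y: "0 \<le> y" "y \<le> 2 * pi" "cis y \<notin> spectrum I"
  obtains \<eta> M where "0 < \<eta>" "\<And>t u. \<bar>t - y\<bar> < \<eta> \<Longrightarrow> has_boundary_value f t u \<Longrightarrow> norm u \<le> M"
proof -
  obtain c d where c: "0 < c" and d: "0 < d"
    and cI: "\<And>z. norm z < 1 \<Longrightarrow> dist z (cis y) < d \<Longrightarrow> c < norm (I z)"
    using bounded_below_off_spectrum[OF _ y(3)] by auto
  have fh: "f holomorphic_on ball 0 1" and \<psi>h: "\<psi> holomorphic_on ball 0 1"
    using f \<psi> by (auto simp: hardy_space_iff)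
  have "isCont exp (Complex 0 y)" by simp
  then obtain \<eta>0 where \<eta>0: "0 < \<eta>0" "\<And>w. dist w (Complex 0 y) < \<eta>0 \<Longrightarrow> dist (exp w) (cis y) < d"
    unfolding continuous_at_eps_delta using d by (metis exp_Complex exp_zero rcis_def mult_1 of_real_1)
  \<comment> \<open>The quarter keeps the strips of size \<open>2 * \<eta>\<close> within distance
    \<open>\<eta>0\<close> of the centre, where \<open>I\<close> is bounded below on the disk side;
    the bound 1/2 gives \<open>-1 \<le> Re w\<close> as \<open>one_minus_exp_ge\<close>
    requires.\<close>
  define \<eta> where "\<eta> = min (1/2) (\<eta>0 / 4)"
  have \<eta>: "0 < \<eta>" "\<eta> \<le> 1/2" "4 * \<eta> \<le> \<eta>0" using \<eta>0 by (auto simp: \<eta>_def)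
  let ?S1 = "{w. -2*\<eta> < Re w \<and> Re w < 0 \<and> \<bar>Im w - y\<bar> < 2*\<eta>}"
  let ?S2 = "{w. 0 < Re w \<and> Re w < 2*\<eta> \<and> \<bar>Im w - y\<bar> < 2*\<eta>}"
  have S1d: "norm (exp w) < 1" and S1I: "c < norm (I (exp w))" if "w \<in> ?S1" for w
  proof -
    show n: "norm (exp w) < 1" using that by simp
    have "dist w (Complex 0 y) \<le> \<bar>Re w\<bar> + \<bar>Im w - y\<bar>"
      using cmod_le[of "w - Complex 0 y"] by (simp add: dist_norm)
    also have "\<dots> < \<eta>0" using that \<eta> by auto
    finally show "c < norm (I (exp w))" by (intro cI n \<eta>0(2))
  qed
  define R where "R z = \<psi> z / I z" for z
  define G1 where "G1 w = f (exp w)" for w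
  define H where "H w = R (exp w)" for w
  define G2 where "G2 w = cnj (H (- cnj w))" for w
  have eS: "exp ` ?S1 \<subseteq> ball 0 1" using S1d by auto
  have comp: "(\<lambda>w. h (exp w)) holomorphic_on ?S1" if "h holomorphic_on ball 0 1" for h :: "complex \<Rightarrow> complex"
    using holomorphic_on_compose_gen[OF _ that eS] by (simp add: o_def holomorphic_on_exp)
  have G1h: "G1 holomorphic_on ?S1" unfolding G1_def by (rule comp[OF fh])
  have Hh: "H holomorphic_on ?S1"
    unfolding H_def R_def using S1I c by (intro holomorphic_intros comp \<psi>h I) force
  have G2h: "G2 holomorphic_on ?S2"
  proof -
    have "(H \<circ> uminus) holomorphic_on cnj ` ?S2"
      by (rule holomorphic_on_compose_gen[OF _ Hh]) (auto intro!: holomorphic_intros)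
    moreover have "?S2 = box (Complex 0 (y-2*\<eta>)) (Complex (2*\<eta>) (y+2*\<eta>))"
      by (auto simp: in_box_complex_iff abs_less_iff)
    then have "open ?S2" by (metis open_box)
    ultimately have "cnj \<circ> (H \<circ> uminus) \<circ> cnj holomorphic_on ?S2"
      by (rule holomorphic_on_compose_cnj_cnj)
    then show ?thesis by (simp add: G2_def[abs_def] o_def)
  qed
  define C' where "C' = 2 * C * (1 + 1 / c)"
  have C': "0 \<le> C'" "2 * C \<le> C'" "2 * C / c \<le> C'" using C c by (auto simp: C'_def field_simps)
  have gr: "norm (h (exp w)) \<le> 2 * C / \<bar>Re w\<bar>"
    if "w \<in> ?S1" and h: "\<And>z. norm z < 1 \<Longrightarrow> norm (h z) \<le> C / (1 - norm z)"
    for w and h :: "complex \<Rightarrow> complex"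
  proof -
    have "norm (h (exp w)) \<le> C / (1 - exp (Re w))" using h[OF S1d[OF that(1)]] by simp
    also have "\<dots> \<le> C / (\<bar>Re w\<bar> / 2)"
      using that one_minus_exp_ge[of "Re w"] C \<eta> by (intro divide_left_mono mult_pos_pos) auto
    finally show ?thesis by (simp add: mult.commute)
  qed
  have g1: "norm (G1 w) \<le> C' / \<bar>Re w\<bar>" if "w \<in> ?S1" for w
    using gr[OF that C(2)] C'(2) divide_right_mono[of "2*C" C' "\<bar>Re w\<bar>"] unfolding G1_def by force
  have gH: "norm (H w) \<le> C' / \<bar>Re w\<bar>" if "w \<in> ?S1" for w
  proof -
    have "norm (H w) \<le> (2 * C / \<bar>Re w\<bar>) / c"
      unfolding H_def R_def norm_divide using gr[OF that C(3)] S1I[OF that] c C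
      by (intro frac_le) auto
    also have "\<dots> = (2 * C / c) / \<bar>Re w\<bar>" by simp
    also have "\<dots> \<le> C' / \<bar>Re w\<bar>" using C' by (intro divide_right_mono) auto
    finally show ?thesis .
  qed
  \<comment> \<open>The vertical line at \<open>- \<epsilon> j\<close> corresponds to the circle of
    radius \<open>radius j\<close>, so the Hardy bounds on circles become bounds on the inner
    edges.\<close>
  define \<epsilon> where "\<epsilon> j = - ln (radius j)" for j
  have ex: "exp (Complex (- \<epsilon> j) t) = rcis (radius j) t" for j t
    by (simp add: exp_Complex \<epsilon>_def)
  have \<epsilon>0: "0 < \<epsilon> j" for j by (simp add: \<epsilon>_def ln_less_zero)
  have "(\<lambda>j. - ln (radius j)) \<longlonglongrightarrow> - ln 1" by (intro tendsto_intros radius_tendsto) simp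
  then have \<epsilon>lim: "\<epsilon> \<longlonglongrightarrow> 0" by (simp add: \<epsilon>_def[abs_def])
  have G1\<epsilon>: "G1 (Complex (- \<epsilon> j) t) = f (rcis (radius j) t)" for j t
    by (simp add: G1_def ex)
  have G2\<epsilon>: "G2 (Complex (\<epsilon> j) t) = cnj (R (rcis (radius j) t))" for j t
  proof -
    have "- cnj (Complex (\<epsilon> j) t) = Complex (- \<epsilon> j) t" by (simp add: complex_eq_iff)
    then show ?thesis by (simp add: G2_def H_def ex)
  qed
  have yint: "- 2 * pi \<le> y - \<eta>" "y + \<eta> \<le> 4 * pi" using y \<eta> pi_gt3 by linarith+
  let ?M = "lebesgue_on {y-\<eta>..y+\<eta>}"
  have "AE t in ?M. \<exists>u v w. has_boundary_value f t u \<and> has_boundary_value I t v \<and>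
         has_boundary_value \<psi> t w \<and> u = v * cnj w \<and> norm v = 1"
    by (rule AE_periodic_interval[OF bv _ yint]) simp
  then have lim: "AE t in ?M. \<exists>l. (\<lambda>j. G1 (Complex (- \<epsilon> j) t)) \<longlonglongrightarrow> l \<and>
        (\<lambda>j. G2 (Complex (\<epsilon> j) t)) \<longlonglongrightarrow> l"
  proof eventually_elim
    case (elim t)
    then obtain u v w where b: "has_boundary_value f t u" "has_boundary_value I t v"
      "has_boundary_value \<psi> t w" "u = v * cnj w" "norm v = 1" by blast
    have v0: "v \<noteq> 0" using b by auto
    have "(\<lambda>j. G2 (Complex (\<epsilon> j) t)) \<longlonglongrightarrow> cnj (w / v)"
      unfolding G2\<epsilon> R_def using v0 by (intro tendsto_intros has_boundary_value_radius b)
    moreover have "cnj (w / v) = u"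
    proof -
      have "v * cnj v = 1" using b(5) complex_norm_square[of v] by simp
      then show ?thesis using b(4) v0 by (simp add: divide_simps mult_ac)
    qed
    moreover have "(\<lambda>j. G1 (Complex (- \<epsilon> j) t)) \<longlonglongrightarrow> u"
      unfolding G1\<epsilon> by (intro has_boundary_value_radius b)
    ultimately show ?case by auto
  qed
  obtain B1 where B1: "0 \<le> B1" "\<And>x. 0 \<le> x \<Longrightarrow> x < 1 \<Longrightarrow>
      (LINT t|circle_measure. norm (f (rcis x t)) powr r) \<le> B1"
    using f unfolding hardy_space_iff by auto
  obtain B2 where B2: "0 \<le> B2" "\<And>x. 0 \<le> x \<Longrightarrow> x < 1 \<Longrightarrow>
      (LINT t|circle_measure. norm (\<psi> (rcis x t)) powr r) \<le> B2"
    using \<psi> unfolding hardy_space_iff by auto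
  have cp: "continuous_on A (\<lambda>t. norm (h (rcis (radius j) t)) powr r)"
    if "h holomorphic_on ball 0 1" for h j A
    using r by (intro continuous_intros continuous_on_powr' continuous_on_circle_compose that) auto
  have ib: "(LINT t|?M. norm (h (rcis (radius j) t)) powr r) \<le> 3 * B"
    if "h holomorphic_on ball 0 1"
      "(LINT t|circle_measure. norm (h (rcis (radius j) t)) powr r) \<le> B" for h j B
    using periodic_integral_le[OF cp[OF that(1)] _ _ yint, of j] that(2) by fastforce
  define B where "B = 3 * B1 + c powr - r * (3 * B2)"
  have b1: "(LINT t|?M. norm (G1 (Complex (- \<epsilon> j) t)) powr r) \<le> B" for j
    using ib[OF fh B1(2)] B2(1) unfolding G1\<epsilon> B_def by (simp add: add_increasing2)
  \<comment> \<open>The condition on \<open>j\<close> places the line at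
    \<open>- \<epsilon> j\<close> inside the strip where \<open>I\<close> is bounded below;
    elsewhere the quotient \<open>\<psi> / I\<close> is not controlled.\<close>
  have b2: "(LINT t|?M. norm (G2 (Complex (\<epsilon> j) t)) powr r) \<le> B" if "\<epsilon> j < \<eta>" for j
  proof -
    have pt: "norm (R (rcis (radius j) t)) powr r \<le> c powr - r * norm (\<psi> (rcis (radius j) t)) powr r"
      and In: "I (rcis (radius j) t) \<noteq> 0" if "t \<in> {y-\<eta>..y+\<eta>}" for t
    proof -
      have "Complex (- \<epsilon> j) t \<in> ?S1" using that \<open>\<epsilon> j < \<eta>\<close> \<epsilon>0[of j] \<eta> by (auto simp: abs_less_iff)
      from S1I[OF this] have I': "c < norm (I (rcis (radius j) t))" by (simp add: ex)
      then show "I (rcis (radius j) t) \<noteq> 0" using c by auto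
      have "norm (R (rcis (radius j) t)) \<le> norm (\<psi> (rcis (radius j) t)) / c"
        unfolding R_def norm_divide using I' c by (intro frac_le) auto
      then have "norm (R (rcis (radius j) t)) powr r \<le> (norm (\<psi> (rcis (radius j) t)) / c) powr r"
        using r by (intro powr_mono2) auto
      also have "\<dots> = c powr - r * norm (\<psi> (rcis (radius j) t)) powr r"
        using c by (simp add: powr_divide powr_minus_divide)
      finally show "norm (R (rcis (radius j) t)) powr r \<le> c powr - r * norm (\<psi> (rcis (radius j) t)) powr r" .
    qed
    have "continuous_on {y-\<eta>..y+\<eta>} (\<lambda>t. norm (R (rcis (radius j) t)) powr r)"
      unfolding R_def using r In
      by (intro continuous_intros continuous_on_powr' continuous_on_circle_compose \<psi>h I) auto
    from continuous_imp_integrable_real[OF this]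
    have "(LINT t|?M. norm (R (rcis (radius j) t)) powr r)
        \<le> (LINT t|?M. c powr - r * norm (\<psi> (rcis (radius j) t)) powr r)"
      by (rule integral_mono) (auto intro!: pt cp \<psi>h continuous_imp_integrable_real)
    also have "\<dots> \<le> c powr - r * (3 * B2)"
      using ib[OF \<psi>h B2(2)[of "radius j"]] by (simp add: mult_left_mono)
    also have "\<dots> \<le> B" using B1 by (simp add: B_def)
    finally show ?thesis unfolding G2\<epsilon> complex_mod_cnj .
  qed
  let ?K = "288 * C' / (pi * \<eta>\<^sup>2)"
  have bound: "norm (G1 w0) \<le> ?K"
    if "-\<eta>/2 < Re w0" "Re w0 < 0" "\<bar>Im w0 - y\<bar> < \<eta>/2" for w0
  proof (rule glued_function_bounded[OF \<eta>(1) _ C'(1) r G1h G2h _ _ \<epsilon>0 \<epsilon>lim lim b1 b2 that])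
    show "\<eta> \<le> 1" using \<eta> by simp
    show "norm (G1 w) \<le> C' / \<bar>Re w\<bar>" if "-2*\<eta> < Re w" "Re w < 0" "\<bar>Im w - y\<bar> < 2*\<eta>" for w
      using that by (intro g1) auto
    show "norm (G2 w) \<le> C' / \<bar>Re w\<bar>" if "0 < Re w" "Re w < 2*\<eta>" "\<bar>Im w - y\<bar> < 2*\<eta>" for w
      using that gH[of "- cnj w"] by (simp add: G2_def)
  qed auto
  show thesis
  proof (rule that[of "\<eta> / 2" ?K])
    fix t u assume t: "\<bar>t - y\<bar> < \<eta> / 2" and u: "has_boundary_value f t u"
    have "(\<lambda>j. norm (G1 (Complex (- \<epsilon> j) t))) \<longlonglongrightarrow> norm u"
      unfolding G1\<epsilon> by (intro tendsto_norm has_boundary_value_radius u)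
    moreover have "\<forall>\<^sub>F j in sequentially. \<epsilon> j < \<eta> / 2"
      using \<eta>(1) by (intro order_tendstoD(2)[OF \<epsilon>lim]) simp
    then have "\<forall>\<^sub>F j in sequentially. norm (G1 (Complex (- \<epsilon> j) t)) \<le> ?K"
    proof eventually_elim
      case (elim j)
      then show ?case using \<epsilon>0[of j] t by (intro bound) auto
    qed
    ultimately show "norm u \<le> ?K" by (rule tendsto_upperbound) simp
  qed (use \<eta> in simp)
qed

section \<open>Comparison of the weighted and the unweighted model space\<close>

theorem corollary2:
  fixes p q s \<delta> :: real and I g :: "complex \<Rightarrow> complex" and \<Gamma> :: "complex set"
  assumes "1 < p" and "1 / p + 1 / q = 1"
    and "inner_function I"
    and "closed_arc \<Gamma>" and "\<Gamma> \<inter> spectrum I = {}"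
    and "outer_function g" and "g \<in> hardy_space p"
    and "0 < \<delta>"
    and "AE t in circle_measure. cis t \<notin> \<Gamma> \<longrightarrow>
           (\<exists>w. has_boundary_value g t w \<and> \<delta> \<le> norm w)"
    and "q < s" and "boundary_in_Lp s \<Gamma> (\<lambda>z. 1 / g z)"
  shows "weighted_model_space p I g \<subseteq> model_space p I \<and>
    (bounded (g ` ball 0 1) \<longrightarrow> weighted_model_space p I g = model_space p I)"
proof -
  have q: "1 < q" 
  proof -
    have q1: "1 / q = 1 - 1 / p" using assms(2) by simp
    have "1 / p < 1" "0 < 1 / p" using assms(1) by auto
    then have "0 < 1 / q" "1 / q < 1" using q1 by auto
    then show ?thesis by (simp add: divide_less_eq_1 zero_less_divide_iff)
  qed
  have s: "0 < s" using q assms by simp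
  \<comment> \<open>The Hoelder exponent of a product of functions in \<open>L\<^sup>p\<close> and
    \<open>L\<^sup>s\<close>. It exceeds 1 because
    \<open>1 / p + 1 / s < 1 / p + 1 / q = 1\<close>.\<close>
  define r where "r = 1 / (1 / p + 1 / s)"
  have "1 / s < 1 / q" using assms q by (simp add: frac_less2)
  then have ps: "1 / p + 1 / s < 1" "0 < 1 / p + 1 / s" using assms s by (auto intro: add_pos_pos)
  then have r: "1 < r" "1 / r = 1 / p + 1 / s" by (auto simp: r_def)
  have g0: "g z \<noteq> 0" if "norm z < 1" for z
    using assms(6) that unfolding outer_function_def by auto
  have \<Gamma>c: "compact \<Gamma>"
    using assms(4) unfolding closed_arc_def by (auto intro!: compact_continuous_image continuous_intros)
  have \<Gamma>b: "\<Gamma> \<in> sets borel" using compact_imp_closed[OF \<Gamma>c] by simp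
  have Ih: "I holomorphic_on ball 0 1" and
    I1: "AE t in circle_measure. \<exists>w. has_boundary_value I t w \<and> norm w = 1"
    using assms(3) by (auto simp: inner_function_def)
  \<comment> \<open>\<open>f\<close> and \<open>\<psi>\<close> are treated together: the unweighted
    model space also requires \<open>\<psi>\<close> to be in \<open>H\<^sup>p\<close>, and the bound
    for \<open>f\<close> near \<open>\<Gamma>\<close> uses both.\<close>
  have sub: "f \<in> hardy_space p \<and> \<psi> \<in> hardy_space p"
    if f: "f \<in> weighted_hardy_space p g" and \<psi>: "\<psi> \<in> weighted_hardy_space p g"
      and rel: "AE t in circle_measure. \<exists>u v w. has_boundary_value f t u \<and> has_boundary_value I t v \<and>
         has_boundary_value \<psi> t w \<and> u = v * cnj w" for f \<psi>
  proof -
    have fh: "f holomorphic_on ball 0 1" "\<psi> holomorphic_on ball 0 1"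
      and fg: "(\<lambda>z. f z * g z) \<in> hardy_space p" "(\<lambda>z. \<psi> z * g z) \<in> hardy_space p"
      using f \<psi> by (auto simp: weighted_hardy_space_def)
    have bv: "AE t in circle_measure. \<exists>u v w. has_boundary_value f t u \<and> has_boundary_value I t v \<and>
         has_boundary_value \<psi> t w \<and> u = v * cnj w \<and> norm v = 1"
      using rel I1
    proof eventually_elim
      case (elim t)
      then obtain u v w x where "has_boundary_value f t u" "has_boundary_value I t v"
        "has_boundary_value \<psi> t w" "u = v * cnj w" "has_boundary_value I t x" "norm x = 1" by blast
      moreover from this have "v = x"
        using LIMSEQ_unique has_boundary_value_radius by blast
      ultimately show ?case by blast
    qed
    \<comment> \<open>\<open>lim\<close> yields a function that is measurable on the whole interval.
      It is the boundary value of \<open>f\<close> almost everywhere, and its arbitrary value where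
      the sequence diverges concerns a null set only.\<close>
    define fs where "fs t = lim (\<lambda>j. f (rcis (radius j) t))" for t
    have [measurable]: "(\<lambda>t. f (rcis (radius j) t)) \<in> borel_measurable circle_measure" for j
      by (intro measurable_circle_compose fh) auto
    have fsm[measurable]: "fs \<in> borel_measurable circle_measure" unfolding fs_def by measurable
    have fs: "AE t in circle_measure. has_boundary_value f t (fs t) \<and>
        (\<exists>w. has_boundary_value \<psi> t w \<and> norm w = norm (fs t))"
      using bv
    proof eventually_elim
      case (elim t)
      then obtain u v w where b: "has_boundary_value f t u" "has_boundary_value \<psi> t w"
        "u = v * cnj w" "norm v = 1" by blast
      have "fs t = u" unfolding fs_def by (intro limI has_boundary_value_radius b)
      with b show ?case by (auto simp: norm_mult)
    qed
    have fsl: "AE t in circle_measure. (\<lambda>j. f (rcis (radius j) t)) \<longlonglongrightarrow> fs t"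
      using fs by eventually_elim (auto intro: has_boundary_value_radius)
    have off: "integrable circle_measure (\<lambda>t. indicator (- \<Gamma>) (cis t) * norm (fs t) powr p)"
      and fsr: "integrable circle_measure (\<lambda>t. norm (fs t) powr r)"
      by (rule quotient_boundary_integrable[OF _ s _ r(2) fg(1) g0 assms(8,9,11) \<Gamma>b fsl fsm];
          use assms(1) r(1) in simp)+
    have fs1: "integrable circle_measure (\<lambda>t. norm (fs t))"
      by (rule circle.integrable_of_powr[of r]) (use r fsr in auto)
    have pf: "norm (f z) \<le> 1 / (2 * pi) * (LINT t|circle_measure. poisson_kernel z t * norm (fs t))"
      if "norm z < 1" for z
    proof (rule outer_multiplier_poisson_bound[OF assms(1) fh(1) assms(6) fg(1) _ fs1 that])
      show "AE t in circle_measure. (\<lambda>j. norm (f (rcis (radius j) t))) \<longlonglongrightarrow> norm (fs t)"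
        using fsl by eventually_elim (rule tendsto_norm)
    qed
    have p\<psi>: "norm (\<psi> z) \<le> 1 / (2 * pi) * (LINT t|circle_measure. poisson_kernel z t * norm (fs t))"
      if "norm z < 1" for z
    proof (rule outer_multiplier_poisson_bound[OF assms(1) fh(2) assms(6) fg(2) _ fs1 that])
      show "AE t in circle_measure. (\<lambda>j. norm (\<psi> (rcis (radius j) t))) \<longlonglongrightarrow> norm (fs t)"
        using fs by eventually_elim (metis has_boundary_value_radius tendsto_norm)
    qed
    have hr: "f \<in> hardy_space r" "\<psi> \<in> hardy_space r"
      using hardy_space_of_poisson_bound[OF _ fh(1) _ fs1 fsr pf] r(1)
        hardy_space_of_poisson_bound[OF _ fh(2) _ fs1 fsr p\<psi>] by auto
    define C where "C = 1 / (2 * pi) * (2 * (LINT t|circle_measure. norm (fs t)))"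
    have C0: "0 \<le> C" by (simp add: C_def)
    have gr: "1 / (2 * pi) * (LINT t|circle_measure. poisson_kernel z t * norm (fs t)) \<le> C / (1 - norm z)"
      if z: "norm z < 1" for z
    proof -
      have "(LINT t|circle_measure. poisson_kernel z t * norm (fs t))
          \<le> (LINT t|circle_measure. 2 / (1 - norm z) * norm (fs t))"
        using poisson_kernel_le[OF z]
        by (intro integral_mono poisson_integrable z fs1 integrable_mult_right mult_right_mono) auto
      then have "1 / (2 * pi) * (LINT t|circle_measure. poisson_kernel z t * norm (fs t))
          \<le> 1 / (2 * pi) * (LINT t|circle_measure. 2 / (1 - norm z) * norm (fs t))"
        by (intro mult_left_mono) auto
      also have "\<dots> = C / (1 - norm z)" by (simp add: C_def)
      finally show ?thesis .
    qed
    have loc: "\<exists>\<eta> M. 0 < \<eta> \<and> (\<forall>t u. \<bar>t - y\<bar> < \<eta> \<longrightarrow> has_boundary_value f t u \<longrightarrow> norm u \<le> M)"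
      if "y \<in> {0..2*pi}" "cis y \<in> \<Gamma>" for y
    proof -
      have "cis y \<notin> spectrum I" using that assms(5) by auto
      then show ?thesis
        using boundary_bounded_off_spectrum[OF r(1) hr Ih C0 order_trans[OF pf gr] order_trans[OF p\<psi> gr] bv, of y]
          that by (metis atLeastAtMost_iff)
    qed
    define T where "T = {0..2*pi} \<inter> cis -` \<Gamma>"
    have "closed (cis -` \<Gamma>)"
      using compact_imp_closed[OF \<Gamma>c] by (intro closed_vimage continuous_intros)
    then have T: "compact T" unfolding T_def by (intro compact_Int_closed) auto
    have "\<forall>y\<in>T. \<exists>\<eta> M. 0 < \<eta> \<and> (\<forall>t u. \<bar>t - y\<bar> < \<eta> \<longrightarrow> has_boundary_value f t u \<longrightarrow> norm u \<le> M)"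
      using loc by (auto simp: T_def)
    then obtain \<eta> m where \<eta>: "\<And>y. y \<in> T \<Longrightarrow> 0 < \<eta> y"
      and m: "\<And>y t u. y \<in> T \<Longrightarrow> \<bar>t - y\<bar> < \<eta> y \<Longrightarrow> has_boundary_value f t u \<Longrightarrow> norm u \<le> m y"
      by metis
    obtain T' where T': "T' \<subseteq> T" "finite T'" "T \<subseteq> (\<Union>y\<in>T'. ball y (\<eta> y))"
      by (rule compactE_image[OF T, of T "\<lambda>y. ball y (\<eta> y)"]) (use \<eta> in auto)
    \<comment> \<open>Compactness has left finitely many local bounds. The sum of their absolute
      values dominates each of them and avoids a maximum over a possibly empty set.\<close>
    define M where "M = (\<Sum>y\<in>T'. \<bar>m y\<bar>)"
    have on: "norm u \<le> M" if "t \<in> T" "has_boundary_value f t u" for t u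
    proof -
      obtain y where y: "y \<in> T'" "t \<in> ball y (\<eta> y)" using subsetD[OF T'(3) \<open>t \<in> T\<close>] by blast
      have "norm u \<le> m y" using m[of y t u] y that T' by (auto simp: dist_real_def abs_minus_commute)
      also have "\<dots> \<le> M" unfolding M_def using member_le_sum[OF y(1), of "\<lambda>y. \<bar>m y\<bar>"] T' by auto
      finally show ?thesis .
    qed
    have fsp: "integrable circle_measure (\<lambda>t. norm (fs t) powr p)"
    proof (rule Bochner_Integration.integrable_bound)
      show "integrable circle_measure (\<lambda>t. indicator (- \<Gamma>) (cis t) * norm (fs t) powr p + M powr p)"
        using off by simp
      have "AE t in circle_measure. t \<in> {0..2*pi}" by (rule AE_I2) simp
      then show "AE t in circle_measure. norm (norm (fs t) powr p)
          \<le> norm (indicator (- \<Gamma>) (cis t) * norm (fs t) powr p + M powr p)"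
        using fs
      proof eventually_elim
        case (elim t)
        show ?case
        proof (cases "cis t \<in> \<Gamma>")
          case True
          then have "norm (fs t) \<le> M" using elim by (intro on) (auto simp: T_def)
          then show ?thesis using True assms(1) by (auto intro!: powr_mono2)
        qed auto
      qed
    qed measurable
    show ?thesis
      \<comment> \<open>The Poisson bounds \<open>pf\<close> and \<open>p\<psi>\<close> do not
        mention an exponent. Now that the modulus is known to be in \<open>L\<^sup>p\<close>, the
        argument that gave \<open>H\<^sup>r\<close> gives \<open>H\<^sup>p\<close>.\<close>
      using hardy_space_of_poisson_bound[OF _ fh(1) _ fs1 fsp pf] assms(1)
        hardy_space_of_poisson_bound[OF _ fh(2) _ fs1 fsp p\<psi>] by auto
  qed
  have 1: "weighted_model_space p I g \<subseteq> model_space p I"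
  proof
    fix f assume "f \<in> weighted_model_space p I g"
    then obtain \<psi> where f: "f \<in> weighted_hardy_space p g" and \<psi>: "\<psi> \<in> weighted_hardy_space p g" "\<psi> 0 = 0"
      and rel: "AE t in circle_measure. \<exists>u v w. has_boundary_value f t u \<and> has_boundary_value I t v \<and>
         has_boundary_value \<psi> t w \<and> u = v * cnj w"
      by (auto simp: weighted_model_space_def weighted_hardy_space0_def)
    from sub[OF f \<psi>(1) rel] \<psi>(2) rel show "f \<in> model_space p I"
      by (auto simp: model_space_def weighted_model_space_def weighted_hardy_space0_def
          weighted_hardy_space_def hardy_space_def)
  qed
  \<comment> \<open>Multiplication by a bounded \<open>g\<close> preserves \<open>H\<^sup>p\<close>,
    and the boundary relation involves only \<open>f\<close>, \<open>I\<close> and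
    \<open>\<psi>\<close>, so the same \<open>\<psi>\<close> serves in the weighted space.\<close>
  have 2: "model_space p I \<subseteq> weighted_model_space p I g" if bd: "bounded (g ` ball 0 1)"
  proof -
    obtain K where K: "0 < K" "\<And>z. norm z < 1 \<Longrightarrow> norm (g z) \<le> K"
      using bd unfolding bounded_pos by auto
    have gh: "g holomorphic_on ball 0 1" using assms(7) by (simp add: hardy_space_def)
    have mult: "(\<lambda>z. h z * g z) \<in> hardy_space p" if h: "h \<in> hardy_space p" for h
    proof -
      have hh: "h holomorphic_on ball 0 1" using h by (simp add: hardy_space_def)
      obtain B where B: "0 \<le> B" "\<And>x. 0 \<le> x \<Longrightarrow> x < 1 \<Longrightarrow>
          (LINT t|circle_measure. norm (h (rcis x t)) powr p) \<le> B"
        using h unfolding hardy_space_iff by auto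
      have hg: "(\<lambda>z. h z * g z) holomorphic_on ball 0 1" by (intro holomorphic_intros hh gh)
      have "(LINT t|circle_measure. norm (h (rcis x t) * g (rcis x t)) powr p) \<le> K powr p * B"
        if x: "0 \<le> x" "x < 1" for x
      proof -
        have "(LINT t|circle_measure. norm (h (rcis x t) * g (rcis x t)) powr p)
            \<le> (LINT t|circle_measure. K powr p * norm (h (rcis x t)) powr p)"
        proof (rule integral_mono)
          show "integrable circle_measure (\<lambda>t. norm (h (rcis x t) * g (rcis x t)) powr p)"
            using integrable_circle_powr[OF hg x] assms(1) by simp
          show "integrable circle_measure (\<lambda>t. K powr p * norm (h (rcis x t)) powr p)"
            using integrable_circle_powr[OF hh x] assms(1) by simp
          fix t
          have "norm (h (rcis x t) * g (rcis x t)) powr p \<le> (K * norm (h (rcis x t))) powr p"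
            using K(2)[of "rcis x t"] x assms(1) 
            by (intro powr_mono2) (auto simp: norm_mult mult.commute intro!: mult_right_mono)
          also have "\<dots> = K powr p * norm (h (rcis x t)) powr p" using K by (simp add: powr_mult)
          finally show "norm (h (rcis x t) * g (rcis x t)) powr p \<le> K powr p * norm (h (rcis x t)) powr p" .
        qed
        also have "\<dots> \<le> K powr p * B" using B(2)[OF x] by (simp add: mult_left_mono)
        finally show ?thesis .
      qed
      moreover have "0 \<le> K powr p * B" using B by simp
      ultimately show ?thesis unfolding hardy_space_iff using hg by blast
    qed
    show ?thesis
      using mult
      by (fastforce simp: model_space_def weighted_model_space_def weighted_hardy_space0_def
          weighted_hardy_space_def)
  qed
  from 1 2 show ?thesis by blast
qed

end
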